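(* Let $P$ be a Sylow $2$-subgroup of the symmetric group $S_n$ and let $x \in S_n$ be chosen uniformly at random. Then $$\Pr\left(P \cap P^x = 1\right) = e^{-1/2} + O(1/n).$$ If instead $P$ is a Sylow $2$-subgroup of the alternating group $A_n$ (and $x \in S_n$ is again chosen uniformly at random), then similarly $$\Pr\left(P \cap P^x = 1\right) = \tfrac{3}{2} e^{-1/2} + O(1/n).$$
   Context: Here $n$ is a positive integer, $P^x = x^{-1} P x$ denotes the conjugate of $P$ by $x$, and $1$ denotes the trivial subgroup. The notation $O(1/n)$ denotes a quantity bounded in absolute value by $C/n$ for an absolute constant $C$ (independent of $n$ and $P$). *)

theory Defs
  imports "HOL-Algebra.Algebra" "HOL-Probability.Probability"
begin

text \<open>Sylow \<open>p\<close>-subgroups, intended for a finite group \<open>G\<close> and a prime \<open>p\<close>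
  (for infinite \<open>G\<close>, \<^term>\<open>Coset.order G\<close> is the junk value 0).\<close>

definition sylow_subgroup :: "nat \<Rightarrow> 'a set \<Rightarrow> ('a, 'b) monoid_scheme \<Rightarrow> bool"
  where "sylow_subgroup p P G \<longleftrightarrow>
    subgroup P G \<and> card P = p ^ multiplicity p (Coset.order G)"

definition conj_set :: "('a, 'b) monoid_scheme \<Rightarrow> 'a set \<Rightarrow> 'a \<Rightarrow> 'a set"
  where "conj_set G P x = (inv\<^bsub>G\<^esub> x <#\<^bsub>G\<^esub> P) #>\<^bsub>G\<^esub> x"

text \<open>The product in \<^term>\<open>sym_group n\<close> is \<open>(\<circ>)\<close>, so permutations act on the left. Under the
  opposite convention \<open>x\<close> is replaced by its inverse, which is again uniformly distributed, so
  the probability below does not depend on the choice.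

  In the alternating case \<open>P\<close> lies in \<^term>\<open>alt_group n\<close> but \<open>x\<close> still ranges over the whole
  symmetric group.\<close>

definition trivial_conj_inter_prob :: "nat \<Rightarrow> (nat \<Rightarrow> nat) set \<Rightarrow> real"
  where "trivial_conj_inter_prob n P =
    measure_pmf.prob (pmf_of_set (carrier (sym_group n)))
      {x. P \<inter> conj_set (sym_group n) P x = {\<one>\<^bsub>sym_group n\<^esub>}}"

end

(* A Sylow 2-subgroup Q of S_n contains exactly the floor(n/2) transpositions that swap the pairs
   {2i-1,2i}. The number of these pairs that a random x maps to pairs is asymptotically Poisson with
   mean 1/2, which inclusion-exclusion shows with error O(1/n). A pair mapped to a pair gives a common
   transposition of Q and its conjugate, so it remains to see that, outside an event of probability
   O(1/n), every common involution z is a product of such transpositions. After removal of these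
   factors one may assume that no pair swapped by z is mapped to a pair; then among the k two-cycles
   of z, and those of its conjugate, at most k in total swap pairs. The other two-cycles belong to
   subgroups acting on larger blocks, which makes such z rare: a generating function bounds the number
   of couples of elements of Q with k two-cycles each by (C n^(3/2) / k)^k, while a given couple is
   matched by x with probability at most (C k / n^2)^k, so that the first moment is at most the sum of
   (C / sqrt n)^k over k >= 2. For S_n the intersection is then trivial iff there is no common pair,
   and for A_n iff there is at most one. *)

theory Submission
  imports Defs
begin

text \<open>A pair to be swapped can be chosen in about n/2 ways, so couples consisting of swaps
  alone would be too numerous to be offset by the matching probability. The saving is that a
  two-cycle which swaps no pair comes from a two-cycle on the pair indices, and each of those lifts
  to two two-cycles at once; two-cycles of this kind therefore cost only about sqrt n each. With at
  most k swaps among the 2k two-cycles of a couple this gives n^(k + k/2), the exponent 3/2. For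
  this reason the generating function has one variable per kind of two-cycle, and the group is built
  from the pairs upwards, so that a single step of the recursion separates the two kinds. Taking
  \<open>n div 2\<close> at each step treats every n at once, without splitting n into powers of 2.
  The rare event is defined by the number of swaps alone, with no factor divided out; outside it a
  pigeonhole argument on the moved points produces a common pair. Only in the alternating case is
  one swap divided out, to obtain a second pair. Involutions suffice because every nontrivial
  element of a 2-group has a power that is one.\<close>

section \<open>Sylow subgroups are conjugate\<close>

text \<open>\<open>P\<close> acts on the cosets of \<open>Q\<close> by right multiplication. Orbit
  sizes divide \<open>p ^ a\<close>; if no orbit were a single coset, \<open>p\<close> would divide
  all of them and hence the number of cosets.\<close>

lemma (in group) fixed_coset_exists:
  assumes fin: "finite (carrier G)" and p: "Factorial_Ring.prime (p::nat)"
    and P: "subgroup P G" "card P = p ^ a" and Q: "subgroup Q G" "\<not> p dvd card (rcosets Q)"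
  shows "\<exists>R\<in>rcosets Q. \<forall>x\<in>P. R #> x = R"
proof -
  define E where "E = rcosets Q"
  define H where "H = G\<lparr>carrier := P\<rparr>"
  \<comment> \<open>The inverse turns right multiplication into a left action, as required by
    \<open>BijGroup\<close>, whose product is composition.\<close>
  define \<phi> where "\<phi> = (\<lambda>x. \<lambda>R\<in>E. R #> inv x)"
  have PG: "P \<subseteq> carrier G" using P(1) by (rule subgroup.subset)
  have QG: "Q \<subseteq> carrier G" using Q(1) by (rule subgroup.subset)
  have EG: "R \<subseteq> carrier G" if "R \<in> E" for R
    using that subgroup.rcosets_carrier[OF Q(1) is_group] unfolding E_def by blast
  have Eclosed: "R #> x \<in> E" if "R \<in> E" "x \<in> carrier G" for R x
    using that QG by (auto simp: E_def RCOSETS_def coset_mult_assoc)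
  have finE: "finite E" unfolding E_def using fin
    using rcosets_subset_PowG[OF Q(1)] by (meson finite_Pow_iff finite_subset)
  have grpH: "group H" unfolding H_def by (rule subgroup_imp_group[OF P(1)])
  have Bij: "\<phi> x \<in> Bij E" if x: "x \<in> P" for x
  proof -
    have xG: "x \<in> carrier G" using x PG by auto
    have "bij_betw (\<lambda>R. R #> inv x) E E"
      by (rule bij_betw_byWitness[where f' = "\<lambda>R. R #> x"])
         (use xG EG Eclosed in \<open>auto simp: coset_mult_assoc\<close>)
    then have "bij_betw (\<phi> x) E E" unfolding \<phi>_def
      by (subst bij_betw_cong[where g = "\<lambda>R. R #> inv x"]) auto
    then show ?thesis unfolding Bij_def by (auto simp: \<phi>_def)
  qed
  have act: "group_action H E \<phi>"
    unfolding group_action_def group_hom_def group_hom_axioms_def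
  proof (intro conjI grpH group_BijGroup homI)
    show "\<phi> x \<in> carrier (BijGroup E)" if "x \<in> carrier H" for x
      using that Bij by (simp add: H_def BijGroup_def)
    fix x y assume xy: "x \<in> carrier H" "y \<in> carrier H"
    then have xyP: "x \<in> P" "y \<in> P" by (auto simp: H_def)
    with PG have xyG: "x \<in> carrier G" "y \<in> carrier G" by auto
    have "\<phi> (x \<otimes> y) R = compose E (\<phi> x) (\<phi> y) R" for R
    proof (cases "R \<in> E")
      case True
      then show ?thesis using xyG EG[OF True] Eclosed
        by (auto simp: \<phi>_def compose_def coset_mult_assoc inv_mult_group)
    qed (auto simp: \<phi>_def compose_def)
    then show "\<phi> (x \<otimes>\<^bsub>H\<^esub> y) = \<phi> x \<otimes>\<^bsub>BijGroup E\<^esub> \<phi> y"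
      using Bij xyP subgroup.m_closed[OF P(1)] by (simp add: H_def BijGroup_def fun_eq_iff)
  qed
  interpret act: group_action H E \<phi> by (rule act)
  show ?thesis
  proof (rule ccontr)
    assume no: "\<not> ?thesis"
    have dvd: "p dvd card (orbit H \<phi> R)" if R: "R \<in> E" for R
    proof -
      have "card (orbit H \<phi> R) * card (stabilizer H \<phi> R) = Coset.order H"
        by (rule act.orbit_stabilizer_theorem[OF R])
      moreover have "Coset.order H = p ^ a" using P(2) by (simp add: H_def Coset.order_def)
      ultimately have "card (orbit H \<phi> R) dvd p ^ a" by (metis dvd_triv_left)
      then obtain b where b: "card (orbit H \<phi> R) = p ^ b"
        using divides_primepow_nat[OF p] by auto
      obtain x where x: "x \<in> P" "R #> x \<noteq> R" using no R unfolding E_def by blast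
      have ix: "inv x \<in> P" using subgroup.m_inv_closed[OF P(1) x(1)] .
      have "R #> x = \<phi> (inv x) R" using x PG R by (auto simp: \<phi>_def)
      then have "R #> x \<in> orbit H \<phi> R" unfolding orbit_def using ix by (auto simp: H_def)
      then have "card (orbit H \<phi> R) \<noteq> 1" using x(2) act.orbit_refl[OF R] by (auto simp: card_1_singleton_iff)
      with b have "b \<noteq> 0" by (cases b) auto
      then show ?thesis using b by auto
    qed
    have "p dvd card (\<Union>(orbits H E \<phi>))"
    proof (rule dvd_partition)
      show "finite (\<Union>(orbits H E \<phi>))" using act.orbits_coverture finE by simp
      show "\<forall>c\<in>orbits H E \<phi>. p dvd card c" using dvd by (auto simp: orbits_def)
      show "\<forall>c1\<in>orbits H E \<phi>. \<forall>c2\<in>orbits H E \<phi>. c1 \<noteq> c2 \<longrightarrow> c1 \<inter> c2 = {}"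
        using act.disjoint_union by blast
    qed
    then show False using act.orbits_coverture Q(2) by (simp add: E_def)
  qed
qed

text \<open>If \<open>P\<close> fixes the coset \<open>Q #> g\<close>, then g x g^-1 lies in
  \<open>Q\<close> for every x in \<open>P\<close>. So \<open>P\<close> lies in a conjugate of
  \<open>Q\<close>, and equal orders force equality. Thus one explicit Sylow subgroup can stand for
  all.\<close>

lemma (in group) sylow_subgroups_conjugate:
  assumes fin: "finite (carrier G)" and p: "Factorial_Ring.prime (p::nat)"
    and P: "sylow_subgroup p P G" and Q: "sylow_subgroup p Q G"
  shows "\<exists>g\<in>carrier G. P = (\<lambda>q. inv g \<otimes> q \<otimes> g) ` Q"
proof -
  have sP: "subgroup P G" and sQ: "subgroup Q G"
    and cP: "card P = p ^ multiplicity p (Coset.order G)" and cQ: "card Q = p ^ multiplicity p (Coset.order G)"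
    using P Q by (auto simp: sylow_subgroup_def)
  have PG: "P \<subseteq> carrier G" and QG: "Q \<subseteq> carrier G" using sP sQ by (auto dest: subgroup.subset)
  have o: "card (rcosets Q) * p ^ multiplicity p (Coset.order G) = Coset.order G"
    using lagrange[OF sQ] cQ by simp
  \<comment> \<open>The order of \<open>Q\<close> already takes up the full power of
    \<open>p\<close>, so the index has none left.\<close>
  have "\<not> p dvd card (rcosets Q)"
  proof
    assume "p dvd card (rcosets Q)"
    then have "p ^ Suc (multiplicity p (Coset.order G)) dvd Coset.order G"
      by (subst (2) o[symmetric]) (auto intro: mult_dvd_mono)
    moreover have "Coset.order G \<noteq> 0" using fin by (simp add: order_gt_0_iff_finite)
    ultimately show False using p
      by (meson Suc_n_not_le_n not_prime_unit power_dvd_iff_le_multiplicity)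
  qed
  then obtain R where R: "R \<in> rcosets Q" "\<And>x. x \<in> P \<Longrightarrow> R #> x = R"
    using fixed_coset_exists[OF fin p sP cP sQ] by auto
  then obtain g where g: "g \<in> carrier G" "R = Q #> g" by (auto simp: RCOSETS_def)
  have "P \<subseteq> (\<lambda>q. inv g \<otimes> q \<otimes> g) ` Q"
  proof
    fix x assume x: "x \<in> P"
    have "g \<in> Q #> g" using subgroup.one_closed[OF sQ] g(1) by (force simp: r_coset_def)
    then have "g \<otimes> x \<in> (Q #> g) #> x" unfolding r_coset_def by blast
    then have "g \<otimes> x \<in> Q #> g" using R(2)[OF x] g by simp
    then obtain q where q: "q \<in> Q" "g \<otimes> x = q \<otimes> g" by (auto simp: r_coset_def)
    have "x = inv g \<otimes> q \<otimes> g" using q g x PG QG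
      by (metis inv_closed inv_solve_left m_assoc m_closed subsetD)
    then show "x \<in> (\<lambda>q. inv g \<otimes> q \<otimes> g) ` Q" using q by auto
  qed
  moreover have "finite Q" using QG fin by (rule finite_subset)
  moreover have "card ((\<lambda>q. inv g \<otimes> q \<otimes> g) ` Q) \<le> card Q" using \<open>finite Q\<close> by (rule card_image_le)
  ultimately have "P = (\<lambda>q. inv g \<otimes> q \<otimes> g) ` Q"
    using cP cQ by (intro card_seteq) auto
  with g show ?thesis by auto
qed

text \<open>For the least \<open>b\<close> with \<open>g [^] (2 ^ b) = \<one>\<close>, the power
  with exponent \<open>2 ^ (b - 1)\<close> is an involution. A nontrivial intersection of 2-groups
  can thus be detected on involutions.\<close>

lemma (in group) exists_involution:
  assumes P: "subgroup P G" "card P = 2 ^ a" and g: "g \<in> P" "g \<noteq> \<one>"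
  shows "\<exists>j::nat. g [^] j \<noteq> \<one> \<and> g [^] j \<otimes> g [^] j = \<one>"
proof -
  have gG: "g \<in> carrier G" by (rule subgroup.mem_carrier[OF P(1) g(1)])
  interpret H: group "G\<lparr>carrier := P\<rparr>" by (rule subgroup_imp_group[OF P(1)])
  have "g [^]\<^bsub>G\<lparr>carrier := P\<rparr>\<^esub> Coset.order (G\<lparr>carrier := P\<rparr>) = \<one>"
    using H.pow_order_eq_1[of g] g by simp
  then have "g [^] (2 ^ a :: nat) = \<one>" using P(2)
    by (simp add: Coset.order_def nat_pow_consistent[symmetric])
  define b where "b = (LEAST b. g [^] (2 ^ b :: nat) = \<one>)"
  have b: "g [^] (2 ^ b :: nat) = \<one>" unfolding b_def
    by (rule LeastI) fact
  have "b \<noteq> 0" using b g gG by (cases b) auto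
  then obtain c where c: "b = Suc c" by (cases b) auto
  have "g [^] (2 ^ c :: nat) \<noteq> \<one>" 
    using not_less_Least[of c "\<lambda>b. g [^] (2 ^ b :: nat) = \<one>"] c by (simp add: b_def)
  moreover have "g [^] (2 ^ c :: nat) \<otimes> g [^] (2 ^ c :: nat) = \<one>"
    using b c gG by (simp add: nat_pow_mult mult_2)
  ultimately show ?thesis by blast
qed

section \<open>The probability as a count, independent of the chosen Sylow subgroup\<close>

definition trivial_inter :: "(nat \<Rightarrow> nat) set \<Rightarrow> (nat \<Rightarrow> nat) \<Rightarrow> bool"
  where "trivial_inter P x \<longleftrightarrow> (\<forall>z\<in>P. x \<circ> z \<circ> inv' x \<in> P \<longrightarrow> z = id)"

lemma conj_set_sym_group:
  assumes x: "x permutes {1..n}"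
  shows "conj_set (sym_group n) P x = {z. x \<circ> z \<circ> inv' x \<in> P}"
proof -
  have "conj_set (sym_group n) P x = (\<lambda>p. inv' x \<circ> p \<circ> x) ` P"
    using x by (auto simp: conj_set_def l_coset_def r_coset_def sym_group_mult sym_group_carrier)
  also have "\<dots> = {z. x \<circ> z \<circ> inv' x \<in> P}"
  proof safe
    fix p assume "p \<in> P"
    moreover have "x \<circ> (inv' x \<circ> p \<circ> x) \<circ> inv' x = p"
      by (simp add: fun_eq_iff permutes_inverses[OF x])
    ultimately show "x \<circ> (inv' x \<circ> p \<circ> x) \<circ> inv' x \<in> P" by simp
  next
    fix z assume z: "x \<circ> z \<circ> inv' x \<in> P"
    have "z = inv' x \<circ> (x \<circ> z \<circ> inv' x) \<circ> x"
      by (simp add: fun_eq_iff permutes_inverses[OF x])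
    with z show "z \<in> (\<lambda>p. inv' x \<circ> p \<circ> x) ` P" by blast
  qed
  finally show ?thesis .
qed

text \<open>With \<open>id\<close> in \<open>P\<close> the intersection always contains
  \<open>id\<close>, so equality with the singleton reduces to \<open>trivial_inter\<close>, which
  says only that nothing else is in it.\<close>

lemma trivial_conj_inter_prob_eq:
  assumes "id \<in> P"
  shows "trivial_conj_inter_prob n P = card {x. x permutes {1..n} \<and> trivial_inter P x} / fact n"
proof -
  have fin: "finite {x. x permutes {1..n}}" by (rule finite_permutations) simp
  have ne: "{x. x permutes {1..n}} \<noteq> {}" using permutes_id by blast
  have iff: "P \<inter> conj_set (sym_group n) P x = {id} \<longleftrightarrow> trivial_inter P x" if "x permutes {1..n}" for x
  proof -
    have "x \<circ> id \<circ> inv' x = id" using that by (simp add: fun_eq_iff permutes_inverses)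
    then show ?thesis using assms unfolding conj_set_sym_group[OF that] trivial_inter_def by auto
  qed
  have "{x. x permutes {1..n}} \<inter> {x. P \<inter> conj_set (sym_group n) P x = {id}}
      = {x. x permutes {1..n} \<and> trivial_inter P x}"
    using iff by blast
  moreover have "carrier (sym_group n) = {x. x permutes {1..n}}" by (simp add: sym_group_def)
  ultimately show ?thesis unfolding trivial_conj_inter_prob_def
    by (simp add: measure_pmf_of_set[OF ne fin] sym_group_one card_permutations[of "{1..n}" n] del: One_nat_def)
qed

text \<open>Conjugation by \<open>g\<close> carries the situation of \<open>P\<close> and x to that
  of \<open>Q\<close> and g x g^-1, and x \<mapsto> g x g^-1 is a bijection of the symmetric
  group.\<close>

lemma card_trivial_inter_conj:
  assumes g: "g permutes {1..n}" and P: "P = (\<lambda>q. inv' g \<circ> q \<circ> g) ` Q"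
  shows "card {x. x permutes {1..n} \<and> trivial_inter P x} = card {x. x permutes {1..n} \<and> trivial_inter Q x}"
proof -
  define c where "c = (\<lambda>q. inv' g \<circ> q \<circ> g)"
  define d where "d = (\<lambda>q. g \<circ> q \<circ> inv' g)"
  note gi = permutes_inverses[OF g]
  have cd: "c (d q) = q" "d (c q) = q" for q
    by (simp_all add: c_def d_def fun_eq_iff gi)
  have perm: "c q permutes {1..n}" "d q permutes {1..n}" if "q permutes {1..n}" for q
    using that g by (simp_all add: c_def d_def permutes_compose permutes_inv)
  have inP: "p \<in> P \<longleftrightarrow> d p \<in> Q" for p
    using cd unfolding P c_def[symmetric] by (metis image_iff)
  have did: "d p = id \<longleftrightarrow> p = id" for p
  proof -
    have "c id = id" by (simp add: c_def fun_eq_iff gi)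
    then show ?thesis by (metis cd)
  qed
  have dinv: "d (x \<circ> z \<circ> inv' x) = d x \<circ> d z \<circ> inv' (d x)" if x: "x permutes {1..n}" for x z
  proof -
    have "inv' (d x) = d (inv' x)"
      by (rule inv_unique_comp) (simp_all add: d_def fun_eq_iff gi permutes_inverses[OF x])
    then show ?thesis by (simp add: d_def fun_eq_iff gi)
  qed
  have triv: "trivial_inter P x \<longleftrightarrow> trivial_inter Q (d x)" if x: "x permutes {1..n}" for x
    unfolding trivial_inter_def using inP did dinv[OF x] cd by metis
  have "bij_betw d {x. x permutes {1..n} \<and> trivial_inter P x} {x. x permutes {1..n} \<and> trivial_inter Q x}"
    by (rule bij_betw_byWitness[where f' = c]) (use cd perm triv in auto)
  then show ?thesis by (rule bij_betw_same_card)
qed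

lemma sylow_sym_group_prob:
  assumes P: "sylow_subgroup 2 P (sym_group n)" and Q: "sylow_subgroup 2 Q (sym_group n)"
  shows "trivial_conj_inter_prob n P = card {x. x permutes {1..n} \<and> trivial_inter Q x} / fact n"
proof -
  have one: "id \<in> P" using P subgroup.one_closed[of P "sym_group n"] by (auto simp: sylow_subgroup_def sym_group_one)
  have fin: "finite (carrier (sym_group n))" by (simp add: sym_group_def finite_permutations)
  obtain g where g: "g \<in> carrier (sym_group n)"
      "P = (\<lambda>q. inv\<^bsub>sym_group n\<^esub> g \<otimes>\<^bsub>sym_group n\<^esub> q \<otimes>\<^bsub>sym_group n\<^esub> g) ` Q"
    using group.sylow_subgroups_conjugate[OF sym_group_is_group fin two_is_prime_nat P Q] by auto
  show ?thesis unfolding trivial_conj_inter_prob_eq[OF one]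
    using card_trivial_inter_conj[of g n P Q] g by (simp add: sym_group_mult sym_group_carrier)
qed

text \<open>Conjugacy is applied inside the alternating group although x ranges over the symmetric
  group: the conjugating element lies in both, so the count over all x is still preserved.\<close>

lemma sylow_alt_group_prob:
  assumes P: "sylow_subgroup 2 P (alt_group n)" and Q: "sylow_subgroup 2 Q (alt_group n)"
  shows "trivial_conj_inter_prob n P = card {x. x permutes {1..n} \<and> trivial_inter Q x} / fact n"
proof -
  have one: "id \<in> P" using P subgroup.one_closed[of P "alt_group n"] by (auto simp: sylow_subgroup_def alt_group_one)
  have "finite {p. p permutes {1..n}}" by (simp add: finite_permutations)
  then have fin: "finite (carrier (alt_group n))" by (rule rev_finite_subset) (auto simp: alt_group_carrier)
  obtain g where g: "g \<in> carrier (alt_group n)"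
      "P = (\<lambda>q. inv\<^bsub>alt_group n\<^esub> g \<otimes>\<^bsub>alt_group n\<^esub> q \<otimes>\<^bsub>alt_group n\<^esub> g) ` Q"
    using group.sylow_subgroups_conjugate[OF alt_group_is_group fin two_is_prime_nat P Q] by auto
  show ?thesis unfolding trivial_conj_inter_prob_eq[OF one]
    using card_trivial_inter_conj[of g n P Q] g
    by (simp add: alt_group_mult alt_group_inv_equality alt_group_carrier)
qed

section \<open>An explicit Sylow 2-subgroup\<close>

text \<open>The points of \<open>{1..2 * m}\<close> are grouped into the pairs \<open>{2 * i - 1, 2 * i}\<close> for \<open>i \<in> {1..m}\<close>;
  \<open>half\<close> is the index of the pair. A permutation of the points that respects the pairs is encoded as
  \<open>lift w B\<close>, where \<open>w\<close> permutes the indices and \<open>B\<close> is the set of those \<open>i\<close> on whose pair the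
  parity is reversed. Thus \<open>dyadic_group\<close> is an iterated wreath product, built from the bottom level.\<close>

definition half :: "nat \<Rightarrow> nat" where "half x = (x + 1) div 2"

text \<open>Pair index and parity are coordinates for the points. Identities about
  \<open>lift\<close> are proved coordinate by coordinate through this rule.\<close>

lemma half_odd_eqI: "half x = half y \<Longrightarrow> odd x = odd y \<Longrightarrow> x = y"
  unfolding half_def by presburger

lemma half_simps: 
  "half (2 * i) = i" "i > 0 \<Longrightarrow> half (2 * i - Suc 0) = i" "half 0 = 0" "half x = 0 \<longleftrightarrow> x = 0"
  unfolding half_def by (presburger)+

definition lift :: "(nat \<Rightarrow> nat) \<Rightarrow> nat set \<Rightarrow> nat \<Rightarrow> nat"
  where "lift w B x = 2 * w (half x) - of_bool (odd x \<noteq> (half x \<in> B))"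

context
  fixes m :: nat and w B
  assumes w: "w permutes {1..m}" and B: "B \<subseteq> {1..m}"
begin

text \<open>Index 0 has only the point 0 above it and is no pair. It is a separate case in the next
  two lemmas, where a subtraction from \<open>2 * 0\<close> would truncate.\<close>

lemma permutes_zero: "w 0 = 0" "w i = 0 \<longleftrightarrow> i = 0"
proof -
  show 0: "w 0 = 0" by (rule permutes_not_in[OF w]) simp
  show "w i = 0 \<longleftrightarrow> i = 0" using 0 permutes_inj[OF w] by (metis injD)
qed

lemma half_lift: "half (lift w B x) = w (half x)"
proof (cases "w (half x) = 0")
  case True
  then show ?thesis using permutes_zero B by (auto simp: lift_def half_simps)
next
  case False
  then show ?thesis by (auto simp: lift_def half_simps of_bool_def)
qed

lemma odd_lift: "odd (lift w B x) \<longleftrightarrow> (odd x \<noteq> (half x \<in> B))"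
proof (cases "w (half x) = 0")
  case True
  then show ?thesis using permutes_zero B by (auto simp: lift_def half_simps)
next
  case False
  then show ?thesis by (auto simp: lift_def half_simps of_bool_def)
qed

end

text \<open>The product law of the wreath product: pair i is reversed once if
  \<open>i \<in> B'\<close> and once more if \<open>w' i \<in> B\<close>, and two reversals cancel,
  hence the exclusive or.\<close>

lemma lift_comp:
  assumes "w permutes {1..m}" "B \<subseteq> {1..m}" "w' permutes {1..m}" "B' \<subseteq> {1..m}"
  shows "lift w B \<circ> lift w' B' = lift (w \<circ> w') {i \<in> {1..m}. (w' i \<in> B) \<noteq> (i \<in> B')}"
proof
  fix x
  have ww: "w \<circ> w' permutes {1..m}" using assms by (simp add: permutes_compose)
  have C: "{i \<in> {1..m}. (w' i \<in> B) \<noteq> (i \<in> B')} \<subseteq> {1..m}" by blast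
  have out: "(w' i \<in> B) \<noteq> (i \<in> B') \<Longrightarrow> i \<in> {1..m}" for i
    using assms permutes_in_image[of w' "{1..m}" i] by (metis subsetD)
  show "(lift w B \<circ> lift w' B') x = lift (w \<circ> w') {i \<in> {1..m}. (w' i \<in> B) \<noteq> (i \<in> B')} x"
  proof (rule half_odd_eqI)
    show "half ((lift w B \<circ> lift w' B') x) = half (lift (w \<circ> w') {i \<in> {1..m}. (w' i \<in> B) \<noteq> (i \<in> B')} x)"
      using assms by (simp only: o_apply half_lift[OF ww C] half_lift)
    show "odd ((lift w B \<circ> lift w' B') x) = odd (lift (w \<circ> w') {i \<in> {1..m}. (w' i \<in> B) \<noteq> (i \<in> B')} x)"
      unfolding odd_lift[OF ww C] using assms out[of "half x"]
      by (auto simp only: o_apply half_lift odd_lift mem_Collect_eq)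
  qed
qed

lemma lift_id: "lift id {} = id"
proof
  show "lift id {} x = id x" for x by (simp add: lift_def half_def)
qed

lemma lift_inject:
  assumes "w permutes {1..m}" "B \<subseteq> {1..m}" "w' permutes {1..m}" "B' \<subseteq> {1..m}"
    and eq: "lift w B = lift w' B'"
  shows "w = w' \<and> B = B'"
proof
  have "half (lift w B (2 * i)) = half (lift w' B' (2 * i))" for i using eq by simp
  then show "w = w'" unfolding half_lift[OF assms(1,2)] half_lift[OF assms(3,4)] by (auto simp: half_simps)
  have "odd (lift w B (2 * i)) = odd (lift w' B' (2 * i))" for i using eq by simp
  then show "B = B'" unfolding odd_lift[OF assms(1,2)] odd_lift[OF assms(3,4)] by (auto simp: half_simps)
qed

lemma lift_inverse:
  assumes "w permutes {1..m}" "B \<subseteq> {1..m}"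
  shows "lift (inv' w) (w ` B) \<circ> lift w B = id" "lift w B \<circ> lift (inv' w) (w ` B) = id"
    "w ` B \<subseteq> {1..m}"
proof -
  note wi = permutes_inverses[OF assms(1)] and wc = permutes_inv_o[OF assms(1)]
  show sub: "w ` B \<subseteq> {1..m}" using assms permutes_image[OF assms(1)] by blast
  have iw: "inv' w permutes {1..m}" using assms(1) by (rule permutes_inv)
  have mem: "w i \<in> w ` B \<longleftrightarrow> i \<in> B" for i using permutes_inj[OF assms(1)] by (simp add: inj_image_mem_iff)
  have mem': "inv' w i \<in> B \<longleftrightarrow> i \<in> w ` B" for i using wi mem by metis
  show "lift (inv' w) (w ` B) \<circ> lift w B = id"
    using lift_comp[OF iw sub assms] by (simp add: mem wc lift_id)
  show "lift w B \<circ> lift (inv' w) (w ` B) = id"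
    using lift_comp[OF assms iw sub] by (simp add: mem' wc lift_id)
qed

lemma lift_permutes:
  assumes "w permutes {1..n div 2}" "B \<subseteq> {1..n div 2}"
  shows "lift w B permutes {1..n}"
proof -
  have "bij (lift w B)" using lift_inverse[OF assms] by (blast intro: o_bij)
  moreover have "lift w B x = x" if x: "x \<notin> {1..n}" for x
  proof -
    \<comment> \<open>For odd \<open>n\<close> the point \<open>n + 1\<close> shares its index with
      \<open>n\<close>, namely \<open>n div 2 + 1\<close>; this index is outside the range, so the
      unpaired point is fixed as well.\<close>
    have nx: "half x \<notin> {1..n div 2}" using x by (auto simp: half_def)
    then have "w (half x) = half x" "half x \<notin> B" using assms by (auto simp: permutes_not_in)
    then show "lift w B x = x"
      using half_lift[OF assms, of x] odd_lift[OF assms, of x] by (metis half_odd_eqI)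
  qed
  ultimately show ?thesis by (simp add: permutes_def bij_iff)
qed

fun dyadic_group :: "nat \<Rightarrow> (nat \<Rightarrow> nat) set"
  where "dyadic_group n = (if n \<le> 1 then {id}
    else (\<lambda>(w, B). lift w B) ` (dyadic_group (n div 2) \<times> Pow {1..n div 2}))"

declare dyadic_group.simps [simp del]

lemma dyadic_group_le_1: "n \<le> 1 \<Longrightarrow> dyadic_group n = {id}"
  by (subst dyadic_group.simps) simp

lemma dyadic_group_rec:
  "n \<ge> 2 \<Longrightarrow> dyadic_group n = (\<lambda>(w, B). lift w B) ` (dyadic_group (n div 2) \<times> Pow {1..n div 2})"
  by (subst dyadic_group.simps) simp

lemma dyadic_group_permutes: "z \<in> dyadic_group n \<Longrightarrow> z permutes {1..n}"
proof (induction n arbitrary: z rule: less_induct)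
  case (less n)
  show ?case
  proof (cases "n \<le> 1")
    case True
    then have "z = id" using less.prems dyadic_group_le_1[of n] by simp
    then show ?thesis by (simp only: permutes_id)
  next
    case False
    then obtain w B where "w \<in> dyadic_group (n div 2)" "B \<subseteq> {1..n div 2}" "z = lift w B"
      using less.prems dyadic_group_rec[of n] by auto
    then show ?thesis using less.IH[of "n div 2" w] lift_permutes False by simp
  qed
qed

lemma finite_dyadic_group: "finite (dyadic_group n)"
  by (rule finite_subset[OF _ finite_permutations[of "{1..n}"]]) (use dyadic_group_permutes in auto)

lemma inj_on_lift:
  "inj_on (\<lambda>(w, B). lift w B) (dyadic_group m \<times> Pow {1..m})"
proof (rule inj_onI, clarify)
  fix w B w' B' assume "w \<in> dyadic_group m" "w' \<in> dyadic_group m" "B \<subseteq> {1..m}" "B' \<subseteq> {1..m}"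
    and "lift w B = lift w' B'"
  then show "w = w' \<and> B = B'" using lift_inject[of w m B w' B'] dyadic_group_permutes by blast
qed

lemma id_in_dyadic_group: "id \<in> dyadic_group n"
proof (induction n rule: less_induct)
  case (less n)
  show ?case
  proof (cases "n \<le> 1")
    case False
    then have "id \<in> dyadic_group (n div 2)" by (intro less) simp
    then have "(id, {}) \<in> dyadic_group (n div 2) \<times> Pow {1..n div 2}" by simp
    then show ?thesis using False lift_id by (simp only: dyadic_group_rec) force
  qed (use dyadic_group_le_1 in blast)
qed

lemma dyadic_groupE:
  assumes "z \<in> dyadic_group n" "\<not> n \<le> 1"
  obtains w B where "w \<in> dyadic_group (n div 2)" "w permutes {1..n div 2}" "B \<subseteq> {1..n div 2}" "z = lift w B"
  using assms dyadic_group_permutes dyadic_group_rec[of n] by auto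

lemma lift_in_dyadic_group:
  assumes "\<not> n \<le> 1" "w \<in> dyadic_group (n div 2)" "B \<subseteq> {1..n div 2}"
  shows "lift w B \<in> dyadic_group n"
  using assms dyadic_group_rec[of n] by auto

lemma comp_in_dyadic_group:
  "z \<in> dyadic_group n \<Longrightarrow> z' \<in> dyadic_group n \<Longrightarrow> z \<circ> z' \<in> dyadic_group n"
proof (induction n arbitrary: z z' rule: less_induct)
  case (less n)
  show ?case
  proof (cases "n \<le> 1")
    case False
    obtain w B where w: "w \<in> dyadic_group (n div 2)" "w permutes {1..n div 2}" "B \<subseteq> {1..n div 2}" "z = lift w B"
      using less.prems(1) False by (rule dyadic_groupE)
    obtain w' B' where w': "w' \<in> dyadic_group (n div 2)" "w' permutes {1..n div 2}" "B' \<subseteq> {1..n div 2}" "z' = lift w' B'"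
      using less.prems(2) False by (rule dyadic_groupE)
    have "w \<circ> w' \<in> dyadic_group (n div 2)" by (rule less.IH) (use w w' False in auto)
    then show ?thesis unfolding w(4) w'(4) lift_comp[OF w(2,3) w'(2,3)]
      by (rule lift_in_dyadic_group[OF False]) blast
  qed (use less.prems in \<open>simp add: dyadic_group_le_1 id_def\<close>)
qed

lemma inv_in_dyadic_group: "z \<in> dyadic_group n \<Longrightarrow> inv' z \<in> dyadic_group n"
proof (induction n arbitrary: z rule: less_induct)
  case (less n)
  show ?case
  proof (cases "n \<le> 1")
    case False
    obtain w B where w: "w \<in> dyadic_group (n div 2)" "w permutes {1..n div 2}" "B \<subseteq> {1..n div 2}" "z = lift w B"
      using less.prems(1) False by (rule dyadic_groupE)
    have "inv' w \<in> dyadic_group (n div 2)" using less.IH[of "n div 2"] w False by simp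
    moreover have "inv' z = lift (inv' w) (w ` B)"
      unfolding w(4) by (rule inv_unique_comp[OF lift_inverse(2,1)[OF w(2,3)]])
    ultimately show ?thesis
      using lift_in_dyadic_group[OF False] lift_inverse(3)[OF w(2,3)] by simp
  qed (use less.prems in \<open>simp add: dyadic_group_le_1 id_def\<close>)
qed

text \<open>Legendre's recursion: the odd factors of the factorial contribute nothing, and the even
  ones are the doubles of 1, ..., \<open>n div 2\<close>.\<close>

lemma multiplicity_2_fact:
  "multiplicity 2 (fact n :: nat) = n div 2 + multiplicity 2 (fact (n div 2) :: nat)"
proof -
  have mult: "multiplicity 2 (a * b) = multiplicity 2 a + multiplicity 2 b" if "a > 0" "b > 0" for a b :: nat
    using that by (simp add: prime_elem_multiplicity_mult_distrib prime_imp_prime_elem)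
  have odd: "multiplicity 2 (Suc (2 * m)) = 0" for m :: nat
    by (rule not_dvd_imp_multiplicity_0) simp
  have even: "multiplicity 2 (fact (2 * m) :: nat) = m + multiplicity 2 (fact m :: nat)" for m
  proof (induction m)
    case (Suc m)
    have "(fact (2 * Suc m) :: nat) = 2 * (Suc m * (Suc (2 * m) * fact (2 * m)))"
      by (simp add: algebra_simps)
    then have "multiplicity 2 (fact (2 * Suc m) :: nat) = Suc (multiplicity 2 (Suc m) + (0 + multiplicity 2 (fact (2 * m) :: nat)))"
      by (simp only: mult odd fact_gt_zero zero_less_Suc mult_pos_pos zero_less_numeral) (simp add: multiplicity_self)
    also have "\<dots> = Suc m + multiplicity 2 (fact (Suc m) :: nat)"
      using Suc by (simp only: fact_Suc of_nat_id mult fact_gt_zero zero_less_Suc)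
    finally show ?case .
  qed simp
  show ?thesis
  proof (cases "even n")
    case True then show ?thesis using even[of "n div 2"] by simp
  next
    case False
    then obtain m where n: "n = Suc (2 * m)" by (metis oddE Suc_eq_plus1)
    have "multiplicity 2 (fact n :: nat) = multiplicity 2 (fact (2 * m) :: nat)"
      unfolding n by (simp only: fact_Suc of_nat_id mult odd fact_gt_zero zero_less_Suc)
    then show ?thesis using even[of m] n by simp
  qed
qed

text \<open>Both sides obey the same recursion: one level of the construction multiplies the order
  by the \<open>2 ^ (n div 2)\<close> choices of \<open>B\<close>, matching the first summand in
  \<open>multiplicity_2_fact\<close>.\<close>

lemma card_dyadic_group: "card (dyadic_group n) = 2 ^ multiplicity 2 (fact n :: nat)"
proof (induction n rule: less_induct)
  case (less n)
  show ?case
  proof (cases "n \<le> 1")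
    case True
    then have "(fact n :: nat) = 1" by (cases n) auto
    then show ?thesis using True by (simp add: dyadic_group_le_1)
  next
    case False
    then have "card (dyadic_group n) = card (dyadic_group (n div 2)) * 2 ^ (n div 2)"
      using card_image[OF inj_on_lift[of "n div 2"]]
      by (simp add: dyadic_group_rec card_cartesian_product card_Pow)
    then show ?thesis using less[of "n div 2"] False multiplicity_2_fact[of n] by (simp add: power_add)
  qed
qed

lemma dyadic_group_sylow: "sylow_subgroup 2 (dyadic_group n) (sym_group n)"
  unfolding sylow_subgroup_def
proof
  have "carrier (sym_group n) = {x. x permutes {1..n}}" by (simp add: sym_group_def)
  then show "subgroup (dyadic_group n) (sym_group n)"
    using dyadic_group_permutes id_in_dyadic_group comp_in_dyadic_group inv_in_dyadic_group
    by (auto intro!: subgroup.intro simp: sym_group_mult sym_group_one sym_group_carrier)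
  show "card (dyadic_group n) = 2 ^ multiplicity 2 (Coset.order (sym_group n))"
    by (simp add: card_dyadic_group Coset.order_def sym_group_card_carrier)
qed

section \<open>Involutions of the explicit subgroup\<close>

definition moved :: "(nat \<Rightarrow> nat) \<Rightarrow> nat set"
  where "moved z = {x. z x \<noteq> x}"

definition flipped :: "nat \<Rightarrow> (nat \<Rightarrow> nat) \<Rightarrow> nat set"
  where "flipped n z = {i \<in> {1..n div 2}. z (2 * i - 1) = 2 * i \<and> z (2 * i) = 2 * i - 1}"

lemma moved_permutes: "z permutes S \<Longrightarrow> moved z \<subseteq> S"
  unfolding moved_def using permutes_not_in by fastforce

lemma moved_empty_iff: "moved z = {} \<longleftrightarrow> z = id"
  by (auto simp: moved_def fun_eq_iff)

text \<open>Index 0 has a single preimage, unlike all others, so \<open>A\<close> has to avoid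
  it.\<close>

lemma card_half_vimage:
  assumes "finite A" "A \<subseteq> {1..}"
  shows "card (half -` A) = 2 * card A"
proof -
  have "half -` A = (\<lambda>i. 2 * i) ` A \<union> (\<lambda>i. 2 * i - 1) ` A"
  proof
    show "half -` A \<subseteq> (\<lambda>i. 2 * i) ` A \<union> (\<lambda>i. 2 * i - 1) ` A"
    proof
      fix x assume x: "x \<in> half -` A"
      have "x = 2 * half x \<or> x = 2 * half x - 1" unfolding half_def by presburger
      then show "x \<in> (\<lambda>i. 2 * i) ` A \<union> (\<lambda>i. 2 * i - 1) ` A" using x by blast
    qed
    show "(\<lambda>i. 2 * i) ` A \<union> (\<lambda>i. 2 * i - 1) ` A \<subseteq> half -` A"
      using assms(2) by (auto simp: half_simps subset_iff Suc_le_eq)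
  qed
  moreover have "(\<lambda>i. 2 * i) ` A \<inter> (\<lambda>i. 2 * i - 1) ` A = {}"
  proof -
    have "2 * i \<noteq> 2 * j - 1" if "j \<in> A" for i j :: nat
    proof -
      have "j \<ge> 1" using that assms(2) by auto
      then show ?thesis by presburger
    qed
    then show ?thesis by blast
  qed
  moreover have "card ((\<lambda>i. 2 * i) ` A) = card A" by (rule card_image) (auto simp: inj_on_def)
  moreover have "card ((\<lambda>i. 2 * i - 1) ` A) = card A"
  proof (rule card_image, rule inj_onI)
    fix i j assume "i \<in> A" "j \<in> A" "2 * i - 1 = 2 * j - 1"
    moreover have "i \<ge> 1" "j \<ge> 1" using \<open>i \<in> A\<close> \<open>j \<in> A\<close> assms(2) by auto
    ultimately show "i = j" by linarith
  qed
  ultimately show ?thesis using assms(1) by (simp add: card_Un_disjoint)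
qed

context
  fixes m :: nat and w B
  assumes w: "w permutes {1..m}" and B: "B \<subseteq> {1..m}"
begin

lemma moved_lift: "moved (lift w B) = half -` (moved w \<union> B)"
proof -
  have "lift w B x = x \<longleftrightarrow> w (half x) = half x \<and> half x \<notin> B" for x
    using half_lift[OF w B, of x] odd_lift[OF w B, of x] half_odd_eqI[of "lift w B x" x] by metis
  then show ?thesis by (auto simp: moved_def)
qed

lemma flipped_lift:
  assumes "m = n div 2"
  shows "flipped n (lift w B) = B - moved w"
proof -
  have "lift w B (2 * i - 1) = 2 * i \<and> lift w B (2 * i) = 2 * i - 1 \<longleftrightarrow> i \<in> B \<and> w i = i" if i: "i \<ge> 1" for i
  proof -
    have h: "half (2 * i - 1) = i" "half (2 * i) = i" "odd (2 * i - 1)" "even (2 * i)" using i half_simps by simp_all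
    have "lift w B (2 * i - 1) = 2 * i \<longleftrightarrow> i \<in> B \<and> w i = i"
      using half_lift[OF w B, of "2 * i - 1"] odd_lift[OF w B, of "2 * i - 1"]
        half_odd_eqI[of "lift w B (2 * i - 1)" "2 * i"] h by metis
    moreover have "lift w B (2 * i) = 2 * i - 1 \<longleftrightarrow> i \<in> B \<and> w i = i"
      using half_lift[OF w B, of "2 * i"] odd_lift[OF w B, of "2 * i"]
        half_odd_eqI[of "lift w B (2 * i)" "2 * i - 1"] h by metis
    ultimately show ?thesis by blast
  qed
  then have "flipped n (lift w B) = {i \<in> {1..m}. i \<in> B \<and> w i = i}" unfolding flipped_def assms by auto
  then show ?thesis using B by (auto simp: moved_def)
qed

lemma finite_moved_lift: "finite (moved w \<union> B)" "moved w \<union> B \<subseteq> {1..}"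
  using moved_permutes[OF w] B by (auto dest: finite_subset)

text \<open>A pair moved by \<open>w\<close> contributes both its points; a pair fixed by
  \<open>w\<close> contributes its points exactly when it is flipped. So the points moved outside
  flipped pairs are twice as many as those moved by \<open>w\<close>, which is the origin of
  \<open>q\<^sup>2\<close> in the recursion for the generating functions.\<close>

lemma card_moved_lift:
  assumes "m = n div 2"
  shows "card (moved (lift w B)) = 2 * card (moved w) + 2 * card (flipped n (lift w B))"
proof -
  have "card (moved w \<union> B) = card (moved w \<union> (B - moved w))" by simp
  also have "\<dots> = card (moved w) + card (B - moved w)"
    using finite_moved_lift by (intro card_Un_disjoint) auto
  finally show ?thesis
    unfolding moved_lift flipped_lift[OF assms] using card_half_vimage[OF finite_moved_lift] by simp
qed

lemma lift_involution_iff: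
  "lift w B \<circ> lift w B = id \<longleftrightarrow> w \<circ> w = id \<and> (\<forall>i\<in>{1..m}. w i \<in> B \<longleftrightarrow> i \<in> B)"
proof -
  define D where "D = {i \<in> {1..m}. (w i \<in> B) \<noteq> (i \<in> B)}"
  have ww: "w \<circ> w permutes {1..m}" using w by (simp only: permutes_compose)
  have D: "D \<subseteq> {1..m}" by (auto simp: D_def)
  have "lift w B \<circ> lift w B = id \<longleftrightarrow> lift (w \<circ> w) D = lift id {}"
    unfolding lift_comp[OF w B w B] lift_id D_def ..
  also have "\<dots> \<longleftrightarrow> w \<circ> w = id \<and> D = {}"
    using lift_inject[OF ww D permutes_id empty_subsetI] by metis
  finally show ?thesis unfolding D_def by blast
qed

end

lemma card_moved_ne_1:
  assumes "inj z" "finite (moved z)" shows "card (moved z) \<noteq> 1"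
proof
  assume "card (moved z) = 1"
  then obtain x where x: "moved z = {x}" by (auto simp: card_1_singleton_iff)
  then have "z x \<noteq> x" "z (z x) = z x" by (auto simp: moved_def)
  then show False using assms(1) by (auto dest: injD)
qed

text \<open>The last claim identifies the transpositions of the group as swaps of pairs: the
  alternative would be a \<open>w\<close> moving exactly one index, and no permutation does
  that.\<close>

lemma dyadic_group_card_moved:
  assumes "z \<in> dyadic_group n"
  shows "2 * card (flipped n z) \<le> card (moved z)" "even (card (moved z))"
    and "card (moved z) = 2 \<Longrightarrow> card (flipped n z) = 1"
proof -
  have "2 * card (flipped n z) \<le> card (moved z) \<and> even (card (moved z))
      \<and> (card (moved z) = 2 \<longrightarrow> card (flipped n z) = 1)"
  proof (cases "n \<le> 1")
    case True
    then have "z = id" using assms by (simp add: dyadic_group_le_1)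
    then have "moved z = {}" by (simp only: moved_empty_iff)
    moreover have "flipped n z = {}" using True by (auto simp: flipped_def)
    ultimately show ?thesis by simp
  next
    case False
    obtain w B where w: "w \<in> dyadic_group (n div 2)" "w permutes {1..n div 2}" "B \<subseteq> {1..n div 2}" "z = lift w B"
      using assms False by (rule dyadic_groupE)
    have "finite (moved w)" using moved_permutes[OF w(2)] by (rule finite_subset) simp
    then have "card (moved w) \<noteq> 1" using card_moved_ne_1 permutes_inj[OF w(2)] by blast
    then show ?thesis using card_moved_lift[OF w(2,3) refl] w(4) by auto
  qed
  then show "2 * card (flipped n z) \<le> card (moved z)" "even (card (moved z))"
    "card (moved z) = 2 \<Longrightarrow> card (flipped n z) = 1" by blast+
qed

section \<open>Generating functions of the involutions\<close>

lemma sum_Pow_power_card: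
  fixes a :: "'a::comm_semiring_1"
  assumes "finite A"
  shows "(\<Sum>S\<in>Pow A. a ^ card S) = (1 + a) ^ card A"
  using prod_add[OF assms, of "\<lambda>_. a" "\<lambda>_. 1"] by (simp add: add.commute)

text \<open>Each two-cycle is represented by its smaller point. This serves both to count invariant
  sets and to count conjugating permutations.\<close>

lemma involution_representatives:
  fixes w :: "nat \<Rightarrow> nat"
  assumes inv: "w \<circ> w = id" and fin: "finite (moved w)"
  defines "R \<equiv> {i. i < w i}"
  shows "moved w = R \<union> w ` R" "card (moved w) = 2 * card R" "finite R"
proof -
  have wi: "w (w i) = i" for i using inv by (simp add: fun_eq_iff)
  show eq: "moved w = R \<union> w ` R"
  proof
    show "moved w \<subseteq> R \<union> w ` R"
    proof
      fix i assume i: "i \<in> moved w"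
      consider "i < w i" | "w i < i" using i by (auto simp: moved_def) linarith
      then show "i \<in> R \<union> w ` R"
      proof cases
        case 2
        then have "w i \<in> R" by (simp add: R_def wi)
        then show ?thesis using wi by (metis UnI2 image_eqI)
      qed (simp add: R_def)
    qed
    show "R \<union> w ` R \<subseteq> moved w" by (auto simp: R_def moved_def wi)
  qed
  show finR: "finite R" by (rule finite_subset[OF _ fin]) (use eq in blast)
  have "R \<inter> w ` R = {}" by (auto simp: R_def wi)
  moreover have "card (w ` R) = card R" by (rule card_image) (metis inj_onI wi)
  ultimately show "card (moved w) = 2 * card R" using eq finR by (simp add: card_Un_disjoint)
qed

text \<open>An invariant \<open>B\<close> is a free choice of fixed points of \<open>w\<close>,
  weighted by \<open>a\<close>, together with a free choice of two-cycles. Writing the factor 2 per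
  two-cycle as \<open>sqrt 2\<close> per moved point lets it be absorbed into the variable of the
  next generating function.\<close>

lemma sum_invariant_subsets_le:
  fixes a :: real
  assumes w: "w permutes {1..m}" and inv: "w \<circ> w = id" and a: "a \<ge> 0"
  shows "(\<Sum>B | B \<subseteq> {1..m} \<and> (\<forall>i\<in>{1..m}. w i \<in> B \<longleftrightarrow> i \<in> B). a ^ card (B - moved w))
    \<le> (1 + a) ^ m * sqrt 2 ^ card (moved w)"
proof -
  define I where "I = {B. B \<subseteq> {1..m} \<and> (\<forall>i\<in>{1..m}. w i \<in> B \<longleftrightarrow> i \<in> B)}"
  define R where "R = {i. i < w i}"
  define F where "F = {1..m} - moved w"
  have wi: "w (w i) = i" for i using inv by (simp add: fun_eq_iff)
  have finm: "finite (moved w)" by (rule finite_subset[OF moved_permutes[OF w]]) simp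
  note R = involution_representatives[OF inv finm, folded R_def]
  note finR = R(3) and cm = R(2)
  \<comment> \<open>Invariance recovers the larger point of each two-cycle from the smaller
    one.\<close>
  have inj: "inj_on (\<lambda>B. (B - moved w, B \<inter> R)) I"
  proof (rule inj_onI)
    fix B B' assume B: "B \<in> I" "B' \<in> I" and eq: "(B - moved w, B \<inter> R) = (B' - moved w, B' \<inter> R)"
    have "i \<in> B \<longleftrightarrow> i \<in> B'" for i
    proof (cases "i \<in> moved w")
      case True
      then consider "i \<in> R" | "w i \<in> R" "i \<in> {1..m}" 
        using R(1) wi moved_permutes[OF w] by force
      then show ?thesis
      proof cases
        case 1 then show ?thesis using eq by blast
      next
        case 2
        then have "i \<in> B \<longleftrightarrow> w i \<in> B" "i \<in> B' \<longleftrightarrow> w i \<in> B'" using B unfolding I_def by blast+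
        then show ?thesis using 2 eq by blast
      qed
    qed (use eq in blast)
    then show "B = B'" by blast
  qed
  have finF: "finite F" by (simp add: F_def)
  have "(\<Sum>B\<in>I. a ^ card (B - moved w))
      = (\<Sum>(S, Y)\<in>(\<lambda>B. (B - moved w, B \<inter> R)) ` I. a ^ card S)"
    by (subst sum.reindex[OF inj]) (simp add: case_prod_beta)
  also have "\<dots> \<le> (\<Sum>(S, Y)\<in>Pow F \<times> Pow R. a ^ card S)"
    by (rule sum_mono2) (use finF finR a in \<open>auto simp: I_def F_def\<close>)
  also have "\<dots> = (\<Sum>S\<in>Pow F. a ^ card S) * 2 ^ card R"
    by (simp add: sum.cartesian_product[symmetric] card_Pow finR sum_distrib_left mult.commute)
  also have "\<dots> = (1 + a) ^ card F * 2 ^ card R" using sum_Pow_power_card[OF finF, of a] by simp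
  also have "(2::real) ^ card R = sqrt 2 ^ card (moved w)" by (simp add: cm power_mult)
  also have "(1 + a) ^ card F \<le> (1 + a) ^ m"
    by (rule power_increasing) (use a card_mono[of "{1..m}" F] in \<open>auto simp: F_def\<close>)
  finally show ?thesis unfolding I_def by (simp add: mult_right_mono)
qed

definition invols :: "nat \<Rightarrow> (nat \<Rightarrow> nat) set"
  where "invols n = {z \<in> dyadic_group n. z \<circ> z = id}"

definition invol_gf :: "nat \<Rightarrow> real \<Rightarrow> real"
  where "invol_gf n q = (\<Sum>z\<in>invols n. q ^ card (moved z))"

text \<open>A swapped pair has weight \<open>a\<close> and every other two-cycle weight
  \<open>q\<^sup>2\<close>. The subtraction in the exponent does not truncate, by
  \<open>dyadic_group_card_moved\<close>.\<close>

definition invol_weight :: "nat \<Rightarrow> real \<Rightarrow> real \<Rightarrow> real"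
  where "invol_weight n a q =
    (\<Sum>z\<in>invols n. a ^ card (flipped n z) * q ^ (card (moved z) - 2 * card (flipped n z)))"

lemma finite_invols: "finite (invols n)"
  unfolding invols_def using finite_dyadic_group by simp

lemma invols_le_1: "n \<le> 1 \<Longrightarrow> invols n = {id}"
proof -
  assume "n \<le> 1"
  then have "z \<in> invols n \<longleftrightarrow> z = id \<and> z \<circ> z = id" for z by (simp only: invols_def dyadic_group_le_1 mem_Collect_eq singleton_iff)
  moreover have "z = id \<and> z \<circ> z = id \<longleftrightarrow> z = id" for z :: "nat \<Rightarrow> nat" by (metis comp_id)
  ultimately show ?thesis by blast
qed

lemma invols_permutes: "z \<in> invols n \<Longrightarrow> z permutes {1..n}"
  unfolding invols_def using dyadic_group_permutes by blast

lemma invol_gf_eq_weight: "invol_gf n q = invol_weight n (q\<^sup>2) q"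
  unfolding invol_gf_def invol_weight_def
proof (rule sum.cong[OF refl])
  fix z assume "z \<in> invols n"
  then have "2 * card (flipped n z) \<le> card (moved z)"
    by (intro dyadic_group_card_moved) (simp add: invols_def)
  then show "q ^ card (moved z) = (q\<^sup>2) ^ card (flipped n z) * q ^ (card (moved z) - 2 * card (flipped n z))"
    by (simp add: power_mult[symmetric] power_add[symmetric])
qed

lemma invol_weight_le_1: "n \<le> 1 \<Longrightarrow> invol_weight n a q = 1"
proof -
  assume n: "n \<le> 1"
  have "moved id = {}" by (simp only: moved_empty_iff)
  moreover have "flipped n id = {}" using n by (auto simp: flipped_def)
  ultimately show ?thesis unfolding invol_weight_def invols_le_1[OF n] by simp
qed

text \<open>In \<open>lift w B\<close> the two-cycles swapping a pair come from the fixed points of \<open>w\<close> in \<open>B\<close>, and each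
  two-cycle of \<open>w\<close> lifts to two two-cycles in two ways, hence the factor \<open>sqrt 2\<close> per moved point.\<close>

lemma invol_weight_rec:
  assumes n: "\<not> n \<le> 1" and a: "a \<ge> 0" and q: "q \<ge> 0"
  shows "invol_weight n a q \<le> (1 + a) ^ (n div 2) * invol_gf (n div 2) (sqrt 2 * q\<^sup>2)"
proof -
  define m where "m = n div 2"
  define J where "J = (\<lambda>w. {B. B \<subseteq> {1..m} \<and> (\<forall>i\<in>{1..m}. w i \<in> B \<longleftrightarrow> i \<in> B)})"
  have invols_eq: "invols n = (\<lambda>(w, B). lift w B) ` (SIGMA w:invols m. J w)" (is "_ = ?R")
  proof
    show "invols n \<subseteq> ?R"
    proof
      fix z assume z: "z \<in> invols n"
      then obtain w B where w: "w \<in> dyadic_group m" "w permutes {1..m}" "B \<subseteq> {1..m}" "z = lift w B"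
        using dyadic_groupE[OF _ n, of z] unfolding invols_def m_def by blast
      have "lift w B \<circ> lift w B = id" using z w(4) unfolding invols_def by blast
      then have "w \<in> invols m" "B \<in> J w" 
        using lift_involution_iff[OF w(2,3)] w(1,3) unfolding invols_def J_def by blast+
      then have "(w, B) \<in> (SIGMA w:invols m. J w)" by blast
      then show "z \<in> ?R" using w(4) by (intro image_eqI[where x = "(w, B)"]) simp_all
    qed
    show "?R \<subseteq> invols n"
    proof clarify
      fix w B assume w: "w \<in> invols m" and B: "B \<in> J w"
      then have "w \<in> dyadic_group m" "w \<circ> w = id" "B \<subseteq> {1..m}" "\<forall>i\<in>{1..m}. w i \<in> B \<longleftrightarrow> i \<in> B"
        by (auto simp only: invols_def J_def)
      then show "lift w B \<in> invols n"
        using lift_in_dyadic_group[OF n] lift_involution_iff[OF invols_permutes[OF w]]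
        unfolding invols_def m_def by blast
    qed
  qed
  have inj: "inj_on (\<lambda>(w, B). lift w B) (SIGMA w:invols m. J w)"
    by (rule inj_on_subset[OF inj_on_lift[of m]]) (auto simp only: invols_def J_def)
  have finJ: "finite (J w)" for w unfolding J_def by (rule finite_subset[of _ "Pow {1..m}"]) auto
  have "invol_weight n a q = (\<Sum>(w, B)\<in>(SIGMA w:invols m. J w). a ^ card (B - moved w) * q ^ (2 * card (moved w)))"
    unfolding invol_weight_def invols_eq sum.reindex[OF inj]
  proof (rule sum.cong[OF refl], clarify)
    fix w B assume "w \<in> invols m" "B \<in> J w"
    then have w: "w permutes {1..m}" and B: "B \<subseteq> {1..m}" using invols_permutes unfolding J_def by blast+
    show "((\<lambda>z. a ^ card (flipped n z) * q ^ (card (moved z) - 2 * card (flipped n z))) \<circ> (\<lambda>(w, B). lift w B)) (w, B)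
      = a ^ card (B - moved w) * q ^ (2 * card (moved w))"
      using card_moved_lift[OF w B m_def] flipped_lift[OF w B m_def] by simp
  qed
  also have "\<dots> = (\<Sum>w\<in>invols m. (\<Sum>B\<in>J w. a ^ card (B - moved w)) * (q\<^sup>2) ^ card (moved w))"
    by (simp add: sum.Sigma[symmetric] finite_invols finJ sum_distrib_right power_mult)
  also have "\<dots> \<le> (\<Sum>w\<in>invols m. ((1 + a) ^ m * sqrt 2 ^ card (moved w)) * (q\<^sup>2) ^ card (moved w))"
  proof (intro sum_mono mult_right_mono)
    fix w assume w: "w \<in> invols m"
    then have "w \<circ> w = id" by (simp only: invols_def mem_Collect_eq)
    then show "(\<Sum>B\<in>J w. a ^ card (B - moved w)) \<le> (1 + a) ^ m * sqrt 2 ^ card (moved w)"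
      unfolding J_def by (rule sum_invariant_subsets_le[OF invols_permutes[OF w] _ a])
  qed simp
  also have "\<dots> = (1 + a) ^ m * invol_gf m (sqrt 2 * q\<^sup>2)"
    by (simp add: invol_gf_def sum_distrib_left power_mult_distrib mult.assoc)
  finally show ?thesis unfolding m_def .
qed

lemma one_plus_power_le_exp: "a \<ge> 0 \<Longrightarrow> (1 + a) ^ m \<le> exp (real m * a)"
  using power_mono[of "1 + a" "exp a" m] by (simp add: exp_of_nat_mult exp_ge_add_one_self)

text \<open>The recursion replaces \<open>q\<close> by \<open>sqrt 2 * q\<^sup>2\<close>, whose
  square \<open>2 * q ^ 4\<close> is at most \<open>q\<^sup>2\<close> because
  \<open>q\<^sup>2 \<le> 1/2\<close>. So the hypothesis persists, and the two exponents add up to at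
  most \<open>2 * m * q\<^sup>2\<close> with \<open>2 * m \<le> n\<close>, which closes the
  induction.\<close>

lemma invol_gf_bound:
  assumes "q \<ge> 0" "q\<^sup>2 \<le> 1/2"
  shows "invol_gf n q \<le> exp (real n * q\<^sup>2)"
  using assms
proof (induction n arbitrary: q rule: less_induct)
  case (less n)
  show ?case
  proof (cases "n \<le> 1")
    case True
    then show ?thesis by (simp add: invol_gf_eq_weight invol_weight_le_1)
  next
    case False
    define m where "m = n div 2"
    have mn: "2 * real m \<le> real n" unfolding m_def by linarith
    have sq: "(sqrt 2 * q\<^sup>2)\<^sup>2 \<le> q\<^sup>2"
    proof -
      have "(sqrt 2 * q\<^sup>2)\<^sup>2 = 2 * q\<^sup>2 * q\<^sup>2" by (simp add: power_mult_distrib power2_eq_square)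
      then show ?thesis using mult_left_mono[OF less.prems(2), of "2 * q\<^sup>2"] by simp
    qed
    have "invol_gf n q \<le> (1 + q\<^sup>2) ^ m * invol_gf m (sqrt 2 * q\<^sup>2)"
      unfolding invol_gf_eq_weight[of n] m_def by (rule invol_weight_rec[OF False]) (use less.prems in auto)
    also have "\<dots> \<le> exp (real m * q\<^sup>2) * exp (real m * (sqrt 2 * q\<^sup>2)\<^sup>2)"
    proof (rule mult_mono)
      show "(1 + q\<^sup>2) ^ m \<le> exp (real m * q\<^sup>2)" by (rule one_plus_power_le_exp) simp
      show "invol_gf m (sqrt 2 * q\<^sup>2) \<le> exp (real m * (sqrt 2 * q\<^sup>2)\<^sup>2)"
      proof (rule less.IH)
        show "m < n" using False by (simp add: m_def)
        show "(sqrt 2 * q\<^sup>2)\<^sup>2 \<le> 1/2" using sq less.prems(2) by linarith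
      qed simp
      show "0 \<le> invol_gf m (sqrt 2 * q\<^sup>2)" unfolding invol_gf_def by (rule sum_nonneg) simp
    qed simp
    also have "\<dots> = exp (real m * (q\<^sup>2 + (sqrt 2 * q\<^sup>2)\<^sup>2))" by (simp add: exp_add[symmetric] ring_distribs)
    also have "\<dots> \<le> exp (real n * q\<^sup>2)"
    proof -
      have "real m * (q\<^sup>2 + (sqrt 2 * q\<^sup>2)\<^sup>2) \<le> real m * (2 * q\<^sup>2)" using sq by (intro mult_left_mono) auto
      also have "\<dots> \<le> real n * q\<^sup>2" using mult_right_mono[OF mn, of "q\<^sup>2"] by simp
      finally show ?thesis by simp
    qed
    finally show ?thesis .
  qed
qed

text \<open>One step of the recursion treats the swapped pairs, and \<open>invol_gf_bound\<close>
  covers the levels above. Two-cycles that swap no pair enter only through \<open>q ^ 4\<close>,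
  that is two at a time; this is the saving on which the first moment rests.\<close>

lemma invol_weight_bound:
  assumes "a \<ge> 0" "q \<ge> 0" "q\<^sup>2 \<le> 1/2"
  shows "invol_weight n a q \<le> exp (real n * (a / 2 + q ^ 4))"
proof (cases "n \<le> 1")
  case True
  then show ?thesis using assms by (simp add: invol_weight_le_1)
next
  case False
  define m where "m = n div 2"
  have mn: "2 * real m \<le> real n" unfolding m_def by linarith
  have sq: "(sqrt 2 * q\<^sup>2)\<^sup>2 = 2 * q ^ 4" by (simp add: power_mult_distrib)
  have q4: "2 * q ^ 4 \<le> 1/2"
    using mult_mono[OF assms(3) assms(3)] assms by (simp add: power2_eq_square power4_eq_xxxx mult.assoc)
  have "invol_weight n a q \<le> (1 + a) ^ m * invol_gf m (sqrt 2 * q\<^sup>2)"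
    unfolding m_def by (rule invol_weight_rec[OF False assms(1,2)])
  also have "\<dots> \<le> exp (real m * a) * exp (real m * (sqrt 2 * q\<^sup>2)\<^sup>2)"
  proof (rule mult_mono)
    show "(1 + a) ^ m \<le> exp (real m * a)" by (rule one_plus_power_le_exp) fact
    show "invol_gf m (sqrt 2 * q\<^sup>2) \<le> exp (real m * (sqrt 2 * q\<^sup>2)\<^sup>2)"
      by (rule invol_gf_bound) (use q4 sq assms in auto)
    show "0 \<le> invol_gf m (sqrt 2 * q\<^sup>2)" unfolding invol_gf_def by (rule sum_nonneg) simp
  qed simp
  also have "\<dots> = exp (2 * real m * (a / 2 + q ^ 4))" by (simp add: exp_add[symmetric] ring_distribs sq)
  also have "\<dots> \<le> exp (real n * (a / 2 + q ^ 4))"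
    using mult_right_mono[OF mn, of "a / 2 + q ^ 4"] assms by simp
  finally show ?thesis .
qed

section \<open>Counting bijections\<close>

text \<open>Separate domain and codomain allow inductions that delete a point and its image, which
  permutations of one set do not; extensionality keeps the set finite.\<close>

definition bij_funs :: "'a set \<Rightarrow> 'b set \<Rightarrow> ('a \<Rightarrow> 'b) set"
  where "bij_funs A B = {f \<in> A \<rightarrow>\<^sub>E B. bij_betw f A B}"

lemma finite_bij_funs: "finite A \<Longrightarrow> finite B \<Longrightarrow> finite (bij_funs A B)"
  unfolding bij_funs_def by (simp add: finite_PiE)

lemma sum_bij_funs:
  assumes fin: "finite A" "finite B" and a: "a \<in> A"
  shows "(\<Sum>f\<in>bij_funs A B. h f) = (\<Sum>b\<in>B. \<Sum>g\<in>bij_funs (A - {a}) (B - {b}). h (g(a := b)))"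
proof -
  have "(\<Sum>f\<in>bij_funs A B. h f)
      = (\<Sum>(b, g)\<in>(SIGMA b:B. bij_funs (A - {a}) (B - {b})). h (g(a := b)))"
  proof (rule sum.reindex_bij_witness[where i = "\<lambda>(b, g). g(a := b)" and j = "\<lambda>f. (f a, restrict f (A - {a}))"])
    fix f assume f: "f \<in> bij_funs A B"
    then have b: "bij_betw f A B" and ext: "f \<in> extensional A" by (auto simp: bij_funs_def PiE_def)
    show eq: "(case (f a, restrict f (A - {a})) of (b, g) \<Rightarrow> g(a := b)) = f"
      using ext by (auto simp: fun_eq_iff extensional_def)
    have "f a \<in> B" using b a by (auto simp: bij_betw_def)
    moreover have "bij_betw f (A - {a}) (B - {f a})" using b a by (auto simp: bij_betw_def inj_on_def)
    then have "bij_betw (restrict f (A - {a})) (A - {a}) (B - {f a})"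
      by (subst bij_betw_cong[where g = f]) auto
    moreover have "restrict f (A - {a}) \<in> A - {a} \<rightarrow>\<^sub>E B - {f a}"
      using \<open>bij_betw f (A - {a}) (B - {f a})\<close> by (auto dest: bij_betwE)
    ultimately show "(f a, restrict f (A - {a})) \<in> (SIGMA b:B. bij_funs (A - {a}) (B - {b}))"
      by (simp add: bij_funs_def)
    show "(case (f a, restrict f (A - {a})) of (b, g) \<Rightarrow> h (g(a := b))) = h f"
      using eq by simp
  next
    fix p assume "p \<in> (SIGMA b:B. bij_funs (A - {a}) (B - {b}))"
    then obtain b g where p: "p = (b, g)" "b \<in> B" and g: "g \<in> bij_funs (A - {a}) (B - {b})" by auto
    then have gb: "bij_betw g (A - {a}) (B - {b})" and gp: "g \<in> A - {a} \<rightarrow>\<^sub>E B - {b}" by (auto simp: bij_funs_def)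
    have "restrict (g(a := b)) (A - {a}) = g"
      using gp by (auto simp: fun_eq_iff PiE_def extensional_def)
    then show "((case p of (b, g) \<Rightarrow> g(a := b)) a, restrict (case p of (b, g) \<Rightarrow> g(a := b)) (A - {a})) = p"
      by (simp add: p)
    have "bij_betw (g(a := b)) (A - {a}) (B - {b})" using gb by (subst bij_betw_cong[where g = g]) auto
    then have "bij_betw (g(a := b)) A B"
      using notIn_Un_bij_betw[of a "A - {a}" "g(a := b)" "B - {b}"] a p(2) by (simp add: insert_absorb)
    moreover have "g(a := b) \<in> A \<rightarrow>\<^sub>E B" using gp a p(2) by (auto simp: PiE_def extensional_def)
    ultimately show "(case p of (b, g) \<Rightarrow> g(a := b)) \<in> bij_funs A B" by (simp add: p bij_funs_def)
  qed
  also have "\<dots> = (\<Sum>b\<in>B. \<Sum>g\<in>bij_funs (A - {a}) (B - {b}). h (g(a := b)))"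
    by (rule sum.Sigma[symmetric]) (use fin in \<open>auto intro!: finite_bij_funs\<close>)
  finally show ?thesis .
qed

lemma card_bij_funs:
  assumes "finite A" "finite B" "card A = n" "card B = n"
  shows "card (bij_funs A B) = fact n"
  using assms
proof (induction n arbitrary: A B)
  case 0
  then show ?case by (simp add: bij_funs_def bij_betw_def)
next
  case (Suc n)
  then obtain a where a: "a \<in> A" by fastforce
  have "card (bij_funs A B) = (\<Sum>b\<in>B. card (bij_funs (A - {a}) (B - {b})))"
    using sum_bij_funs[OF Suc.prems(1,2) a, of "\<lambda>_. 1 :: nat"] by simp
  also have "\<dots> = (\<Sum>b\<in>B. fact n)" by (rule sum.cong[OF refl], rule Suc.IH) (use Suc.prems a in auto)
  finally show ?case using Suc.prems by simp
qed

lemma bij_betw_restrict_permutes: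
  "bij_betw (\<lambda>p. restrict p S) {p. p permutes S} (bij_funs S S)"
proof (rule bij_betw_byWitness[where f' = "\<lambda>f x. if x \<in> S then f x else x"])
  show "\<forall>p\<in>{p. p permutes S}. (\<lambda>x. if x \<in> S then restrict p S x else x) = p"
    by (auto simp: fun_eq_iff permutes_not_in)
  show "\<forall>f\<in>bij_funs S S. restrict (\<lambda>x. if x \<in> S then f x else x) S = f"
    by (auto simp: bij_funs_def fun_eq_iff PiE_def extensional_def)
  show "(\<lambda>p. restrict p S) ` {p. p permutes S} \<subseteq> bij_funs S S"
    by (auto simp: bij_funs_def permutes_imp_bij permutes_in_image)
  show "(\<lambda>f x. if x \<in> S then f x else x) ` bij_funs S S \<subseteq> {p. p permutes S}"
  proof clarify
    fix f assume "f \<in> bij_funs S S"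
    then have "bij_betw f S S" by (simp add: bij_funs_def)
    then have "bij_betw (\<lambda>x. if x \<in> S then f x else x) S S" by (subst bij_betw_cong[where g = f]) auto
    then show "(\<lambda>x. if x \<in> S then f x else x) permutes S" by (rule bij_imp_permutes) simp
  qed
qed

text \<open>Such an x is determined by its values on one point of each two-cycle of
  \<open>z\<close>, which lie among the \<open>2 * k\<close> points moved by \<open>z'\<close>, and
  by the bijection it induces between the unmoved points. Not requiring the representatives to go to
  different two-cycles of \<open>z'\<close> loses only a factor exponential in
  \<open>k\<close>.\<close>

lemma card_conjugators_le:
  assumes z: "z permutes {1..n}" "z \<circ> z = id" "card (moved z) = 2 * k"
    and z': "z' permutes {1..n}" "card (moved z') = 2 * k"
  shows "card {x. x permutes {1..n} \<and> x \<circ> z = z' \<circ> x} \<le> (2 * k) ^ k * fact (n - 2 * k)"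
proof -
  define R where "R = {i. i < z i}"
  define F where "F = {1..n} - moved z"
  define F' where "F' = {1..n} - moved z'"
  have sub: "moved z \<subseteq> {1..n}" "moved z' \<subseteq> {1..n}" using z z' by (auto dest: moved_permutes)
  then have fin: "finite (moved z)" "finite (moved z')" by (auto intro: finite_subset)
  note R = involution_representatives[OF z(2) fin(1), folded R_def]
  have finF: "finite F" "finite F'" by (simp_all add: F_def F'_def)
  have cR: "card R = k" using R(2) z(3) by simp
  have cF: "card F = n - 2 * k" "card F' = n - 2 * k"
    using sub fin z(3) z'(2) by (simp_all add: F_def F'_def card_Diff_subset)
  define U where "U = {x. x permutes {1..n} \<and> x \<circ> z = z' \<circ> x}"
  define \<Phi> where "\<Phi> = (\<lambda>x :: nat \<Rightarrow> nat. (restrict x R, restrict x F))"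
  have comm: "x (z i) = z' (x i)" if "x \<in> U" for x i
    using that unfolding U_def by (auto simp: fun_eq_iff)
  have mv: "x i \<in> moved z' \<longleftrightarrow> i \<in> moved z" if x: "x \<in> U" for x i
  proof -
    have "inj x" using x unfolding U_def by (auto dest: permutes_inj)
    then show ?thesis unfolding moved_def mem_Collect_eq comm[OF x, symmetric] by (simp add: inj_eq)
  qed
  have "inj_on \<Phi> U"
  proof (rule inj_onI)
    fix x y assume xy: "x \<in> U" "y \<in> U" "\<Phi> x = \<Phi> y"
    have r: "restrict x R = restrict y R" "restrict x F = restrict y F" using xy(3) by (auto simp: \<Phi>_def)
    have eR: "x i = y i" if "i \<in> R" for i using fun_cong[OF r(1), of i] that by simp
    have "x i = y i" for i
    proof -
      consider "i \<notin> {1..n}" | "i \<in> F" | "i \<in> R" | j where "j \<in> R" "i = z j"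
        using R(1) unfolding F_def by blast
      then show ?thesis
      proof cases
        case 1 then show ?thesis using xy(1,2) permutes_not_in[of x "{1..n}" i] permutes_not_in[of y "{1..n}" i] unfolding U_def by simp
      next
        case 2 then show ?thesis using fun_cong[OF r(2), of i] by simp
      next
        case 3 then show ?thesis by (rule eR)
      next
        case 4 then show ?thesis using comm[OF xy(1)] comm[OF xy(2)] eR by simp
      qed
    qed
    then show "x = y" by blast
  qed
  moreover have "\<Phi> ` U \<subseteq> (R \<rightarrow>\<^sub>E moved z') \<times> bij_funs F F'"
  proof (rule image_subsetI)
    fix x assume x: "x \<in> U"
    then have px: "x permutes {1..n}" by (simp add: U_def)
    have "restrict x R \<in> R \<rightarrow>\<^sub>E moved z'" using mv[OF x] R(1) by auto
    moreover have im: "x ` F = F'"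
    proof
      show "x ` F \<subseteq> F'" unfolding F_def F'_def using mv[OF x] permutes_in_image[OF px] by blast
      show "F' \<subseteq> x ` F"
      proof
        fix y assume y: "y \<in> F'"
        then obtain i where "y = x i" using permutes_surj[OF px] by blast
        then show "y \<in> x ` F" using y mv[OF x] permutes_in_image[OF px] unfolding F_def F'_def by blast
      qed
    qed
    then have "bij_betw x F F'" using permutes_inj_on[OF px] by (simp add: bij_betw_def)
    then have "bij_betw (restrict x F) F F'" by (subst bij_betw_cong[where g = x]) auto
    then have "restrict x F \<in> bij_funs F F'" using im by (auto simp: bij_funs_def)
    ultimately show "\<Phi> x \<in> (R \<rightarrow>\<^sub>E moved z') \<times> bij_funs F F'" by (simp add: \<Phi>_def)
  qed
  moreover have "finite ((R \<rightarrow>\<^sub>E moved z') \<times> bij_funs F F')"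
    using R(3) fin by (simp add: finite_PiE finite_bij_funs F_def F'_def)
  ultimately have "card U \<le> card ((R \<rightarrow>\<^sub>E moved z') \<times> bij_funs F F')" by (rule card_inj_on_le)
  also have "\<dots> = (2 * k) ^ k * fact (n - 2 * k)"
    using R(3) fin by (simp add: card_cartesian_product card_PiE cR z'(2) card_bij_funs[OF finF cF])
  finally show ?thesis unfolding U_def .
qed

lemma card_ordered_pairs:
  assumes fin: "finite \<T>" and two: "\<And>e. e \<in> \<T> \<Longrightarrow> card e = 2"
  shows "card {(b, b'). {b, b'} \<in> \<T>} = 2 * card \<T>"
proof -
  have "{(b, b'). {b, b'} \<in> \<T>} = (\<Union>e\<in>\<T>. {(b, b'). {b, b'} = e})" by auto
  moreover have "finite {(b, b'). {b, b'} = e} \<and> card {(b, b'). {b, b'} = e} = 2" if "e \<in> \<T>" for e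
  proof -
    obtain c d where e: "e = {c, d}" "c \<noteq> d" using two[OF \<open>e \<in> \<T>\<close>] by (auto simp: card_2_iff)
    have "{(b, b'). {b, b'} = e} = {(c, d), (d, c)}" by (auto simp: e doubleton_eq_iff)
    then show ?thesis using e(2) by simp
  qed
  ultimately have "card {(b, b'). {b, b'} \<in> \<T>} = (\<Sum>e\<in>\<T>. card {(b, b'). {b, b'} = e})"
    by (simp only:) (rule card_UN_disjoint, use fin in auto)
  also have "\<dots> = (\<Sum>e\<in>\<T>. 2)"
    by (rule sum.cong) (use \<open>\<And>e. e \<in> \<T> \<Longrightarrow> finite {(b, b'). {b, b'} = e} \<and> card {(b, b'). {b, b'} = e} = 2\<close> in auto)
  finally show ?thesis by simp
qed

text \<open>Both families are matchings. One edge goes to any edge of \<open>\<T>\<close> in two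
  orientations; by disjointness the other edges then form a smaller instance with that image
  deleted. If \<open>\<S>\<close> has more edges than \<open>\<T>\<close>, truncated subtraction
  gives a zero factor.\<close>

lemma card_bij_funs_pairs:
  assumes "finite \<S>" "finite A" "finite B" "card A = n" "card B = n"
    and "\<And>e. e \<in> \<S> \<Longrightarrow> card e = 2 \<and> e \<subseteq> A" "\<And>e e'. e \<in> \<S> \<Longrightarrow> e' \<in> \<S> \<Longrightarrow> e \<noteq> e' \<Longrightarrow> e \<inter> e' = {}"
    and "finite \<T>"
    and "\<And>e. e \<in> \<T> \<Longrightarrow> card e = 2 \<and> e \<subseteq> B" "\<And>e e'. e \<in> \<T> \<Longrightarrow> e' \<in> \<T> \<Longrightarrow> e \<noteq> e' \<Longrightarrow> e \<inter> e' = {}"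
  shows "card {f \<in> bij_funs A B. \<forall>e\<in>\<S>. f ` e \<in> \<T>}
    = (\<Prod>i<card \<S>. 2 * (card \<T> - i)) * fact (n - 2 * card \<S>)"
  using assms
proof (induction \<S> arbitrary: A B n \<T> rule: finite_induct)
  case empty
  then show ?case by (simp add: card_bij_funs)
next
  case (insert e \<S>)
  note finA = insert.prems(1) and finB = insert.prems(2)
  note T = insert.prems(7,8) and dT = insert.prems(8)
  have "card e = 2" "e \<subseteq> A" using insert.prems(5) by auto
  then obtain a a' where e: "e = {a, a'}" "a \<noteq> a'" "a \<in> A" "a' \<in> A" by (auto simp: card_2_iff)
  define j t where "j = card \<S>" and "t = card \<T>"
  \<comment> \<open>The number of completions once one edge has been placed; it is the same for
    every image edge, so it factors out of the sum.\<close>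
  define N where "N = (\<Prod>i<j. 2 * (t - 1 - i)) * (fact (n - 2 - 2 * j) :: nat)"
  have disj: "s \<inter> e = {}" if "s \<in> \<S>" for s using insert.prems(6)[of s e] insert.hyps that by auto
  have inner: "(\<Sum>g\<in>bij_funs (A - {a} - {a'}) (B - {b} - {b'}).
       of_bool (\<forall>s\<in>insert e \<S>. (g(a' := b', a := b)) ` s \<in> \<T>)) = of_bool ({b, b'} \<in> \<T>) * N"
    (is "?L = _") if b: "b \<in> B" "b' \<in> B - {b}" for b b'
  proof (cases "{b, b'} \<in> \<T>")
    case False
    have "(g(a' := b', a := b)) ` e = {b, b'}" for g :: "'a \<Rightarrow> 'b" using e(2) by (auto simp: e(1))
    then show ?thesis using False by simp
  next
    case True
    have "?L = (\<Sum>g\<in>bij_funs (A - {a} - {a'}) (B - {b} - {b'}). of_bool (\<forall>s\<in>\<S>. g ` s \<in> \<T> - {{b, b'}}))"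
    proof (intro sum.cong refl arg_cong[where f = of_bool])
      fix g assume "g \<in> bij_funs (A - {a} - {a'}) (B - {b} - {b'})"
      then have g: "g ` (A - {a} - {a'}) \<subseteq> B - {b} - {b'}" by (auto simp: bij_funs_def bij_betw_def)
      have "(g(a' := b', a := b)) ` s = g ` s \<and> g ` s \<noteq> {b, b'}" if s: "s \<in> \<S>" for s
      proof
        show "(g(a' := b', a := b)) ` s = g ` s" using disj[OF s] e(1) by (intro image_cong) auto
        have "s \<subseteq> A" "s \<noteq> {}" using insert.prems(5)[of s] s by auto
        then show "g ` s \<noteq> {b, b'}" using g disj[OF s] e(1) by blast
      qed
      moreover have "(g(a' := b', a := b)) ` e = {b, b'}" using e(2) by (auto simp: e(1))
      ultimately show "(\<forall>s\<in>insert e \<S>. (g(a' := b', a := b)) ` s \<in> \<T>) = (\<forall>s\<in>\<S>. g ` s \<in> \<T> - {{b, b'}})"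
        using True by auto
    qed
    also have "\<dots> = card {g \<in> bij_funs (A - {a} - {a'}) (B - {b} - {b'}). \<forall>s\<in>\<S>. g ` s \<in> \<T> - {{b, b'}}}"
      using finite_bij_funs[of "A - {a} - {a'}" "B - {b} - {b'}"] finA finB
      by (simp add: of_bool_def sum.If_cases Int_def conj_commute)
    also have "\<dots> = (\<Prod>i<card \<S>. 2 * (card (\<T> - {{b, b'}}) - i)) * fact (n - 2 - 2 * card \<S>)"
    proof (rule insert.IH)
      show "card (A - {a} - {a'}) = n - 2" "card (B - {b} - {b'}) = n - 2"
        using e b insert.prems(3,4) finA finB by (auto simp: card_Diff_singleton)
      show "card s = 2 \<and> s \<subseteq> A - {a} - {a'}" if "s \<in> \<S>" for s
        using insert.prems(5)[of s] disj[OF that] that e(1) by auto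
      show "card s = 2 \<and> s \<subseteq> B - {b} - {b'}" if "s \<in> \<T> - {{b, b'}}" for s
        using insert.prems(8)[of s] insert.prems(9)[of s "{b, b'}"] that True by auto
      show "s \<inter> s' = {}" if "s \<in> \<S>" "s' \<in> \<S>" "s \<noteq> s'" for s s'
        using insert.prems(6) that by blast
      show "s \<inter> s' = {}" if "s \<in> \<T> - {{b, b'}}" "s' \<in> \<T> - {{b, b'}}" "s \<noteq> s'" for s s'
        using insert.prems(9) that by blast
    qed (use finA finB insert.prems(7) in auto)
    also have "\<dots> = N" using True insert.prems(7) by (simp add: N_def j_def t_def)
    finally show ?thesis using True by simp
  qed
  have "card {f \<in> bij_funs A B. \<forall>s\<in>insert e \<S>. f ` s \<in> \<T>}
      = (\<Sum>f\<in>bij_funs A B. of_bool (\<forall>s\<in>insert e \<S>. f ` s \<in> \<T>))"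
    using finite_bij_funs[OF finA finB] by (simp add: of_bool_def sum.If_cases Int_def conj_commute)
  also have "\<dots> = (\<Sum>b\<in>B. \<Sum>b'\<in>B - {b}. \<Sum>g\<in>bij_funs (A - {a} - {a'}) (B - {b} - {b'}).
       of_bool (\<forall>s\<in>insert e \<S>. (g(a' := b', a := b)) ` s \<in> \<T>))"
    unfolding sum_bij_funs[OF finA finB e(3)]
    by (intro sum.cong refl sum_bij_funs) (use finA finB e in auto)
  also have "\<dots> = (\<Sum>b\<in>B. \<Sum>b'\<in>B - {b}. of_bool ({b, b'} \<in> \<T>) * N)"
    by (intro sum.cong refl inner)
  also have "\<dots> = (\<Sum>b\<in>B. \<Sum>b'\<in>B - {b}. of_bool ({b, b'} \<in> \<T>)) * N"
    by (simp add: sum_distrib_right)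
  also have "(\<Sum>b\<in>B. \<Sum>b'\<in>B - {b}. of_bool ({b, b'} \<in> \<T>)) = card {(b, b'). {b, b'} \<in> \<T>}"
  proof -
    have "(\<Sum>b\<in>B. \<Sum>b'\<in>B - {b}. of_bool ({b, b'} \<in> \<T>))
        = (\<Sum>p\<in>(SIGMA b:B. B - {b}). of_bool ((case p of (b, b') \<Rightarrow> {b, b'}) \<in> \<T>))"
      by (subst sum.Sigma) (use finB in \<open>auto simp: case_prod_beta\<close>)
    also have "\<dots> = card ((SIGMA b:B. B - {b}) \<inter> {p. (case p of (b, b') \<Rightarrow> {b, b'}) \<in> \<T>})"
      using finB by (simp add: of_bool_def sum.If_cases)
    also have "(SIGMA b:B. B - {b}) \<inter> {p. (case p of (b, b') \<Rightarrow> {b, b'}) \<in> \<T>} = {(b, b'). {b, b'} \<in> \<T>}"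
      using insert.prems(8) by fastforce
    finally show ?thesis .
  qed
  also have "card {(b, b'). {b, b'} \<in> \<T>} = 2 * t"
    unfolding t_def by (rule card_ordered_pairs) (use insert.prems(7,8) in auto)
  also have "2 * t * N = (\<Prod>i<card (insert e \<S>). 2 * (t - i)) * fact (n - 2 * card (insert e \<S>))"
    using insert.hyps by (simp add: N_def j_def prod.lessThan_Suc_shift del: prod.lessThan_Suc)
  finally show ?case by (simp add: t_def)
qed

section \<open>Common involutions without a common pair\<close>

text \<open>\<open>x ^ j / fact j\<close> is a single term of the exponential series.\<close>

lemma power_le_exp_fact:
  fixes x :: real
  assumes "x \<ge> 0"
  shows "x ^ j \<le> exp x * fact j"
proof -
  have "(\<Sum>i\<in>{j}. x ^ i /\<^sub>R fact i) \<le> exp x"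
    unfolding exp_def by (rule sum_le_suminf[OF summable_exp_generic]) (use assms in auto)
  then show ?thesis by (simp add: field_simps)
qed

text \<open>The reciprocal of the left side is a binomial coefficient times \<open>fact j\<close>,
  bounded below by \<open>(n / j) ^ j\<close> and \<open>(j / exp 1) ^ j\<close>
  respectively.\<close>

lemma fact_diff_ratio_le:
  assumes "j \<le> n"
  shows "fact (n - j) / fact n \<le> (exp 1 / real n) ^ j"
proof (cases "j = 0")
  case False
  then have j: "real j > 0" "real n > 0" using assms by auto
  have "(real n / exp 1) ^ j = (real n / real j) ^ j * (real j ^ j / exp (real j))"
    using j by (simp add: power_divide exp_of_nat_mult[symmetric])
  also have "\<dots> \<le> real (n choose j) * fact j"
  proof (rule mult_mono)
    show "(real n / real j) ^ j \<le> real (n choose j)"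
      using binomial_ge_n_over_k_pow_k[OF assms, where 'a = real] by simp
    show "real j ^ j / exp (real j) \<le> fact j" using power_le_exp_fact[of "real j" j] by (simp add: field_simps)
  qed auto
  also have "\<dots> = fact n / fact (n - j)" using binomial_fact[OF assms, where 'a = real] by simp
  finally have "inverse (fact n / fact (n - j)) \<le> inverse ((real n / exp 1) ^ j)"
    using j by (intro le_imp_inverse_le) auto
  then show ?thesis by (simp add: power_divide inverse_eq_divide)
qed simp

lemma sum_power_from_2_le:
  fixes y :: real
  assumes "0 \<le> y" "y \<le> 1/2"
  shows "(\<Sum>k=2..N. y ^ k) \<le> 2 * y\<^sup>2"
proof -
  have "(\<Sum>k=2..N. y ^ k) \<le> (\<Sum>k=2..N. y\<^sup>2 * (1/2) ^ (k - 2))"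
  proof (rule sum_mono)
    fix k assume k: "k \<in> {2..N}"
    obtain j where "k = 2 + j" using k le_Suc_ex[of 2 k] by auto
    then have "y ^ k = y\<^sup>2 * y ^ (k - 2)" by (simp add: power2_eq_square)
    also have "\<dots> \<le> y\<^sup>2 * (1/2) ^ (k - 2)" using assms by (intro mult_left_mono power_mono) auto
    finally show "y ^ k \<le> y\<^sup>2 * (1/2) ^ (k - 2)" .
  qed
  also have "\<dots> = y\<^sup>2 * (\<Sum>i\<in>(\<lambda>k. k - 2) ` {2..N}. (1/2) ^ i)"
    by (subst sum.reindex) (auto simp: inj_on_def sum_distrib_left)
  also have "\<dots> \<le> y\<^sup>2 * 2"
  proof (rule mult_left_mono)
    have "(\<Sum>i\<in>(\<lambda>k. k - 2) ` {2..N}. (1/2 :: real) ^ i) \<le> suminf (\<lambda>i. (1/2) ^ i)"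
      by (rule sum_le_suminf) (auto intro: summable_geometric)
    also have "suminf (\<lambda>i. (1/2 :: real) ^ i) = 2" by (subst suminf_geometric) auto
    finally show "(\<Sum>i\<in>(\<lambda>k. k - 2) ` {2..N}. (1/2 :: real) ^ i) \<le> 2" .
  qed simp
  finally show ?thesis by (simp add: mult.commute)
qed

text \<open>As \<open>a \<le> q\<^sup>2\<close> below, each couple in \<open>few_flips n k\<close> has weight at least \<open>(a * q\<^sup>2) ^ k\<close> in
  the square of \<open>invol_weight n a q\<close>. The choice of \<open>a\<close> and \<open>q\<close> makes \<open>(n * a)\<^sup>2 = n * q ^ 4 = k / 2\<close>.\<close>

definition few_flips :: "nat \<Rightarrow> nat \<Rightarrow> ((nat \<Rightarrow> nat) \<times> (nat \<Rightarrow> nat)) set"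
  where "few_flips n k = {(z, z') \<in> invols n \<times> invols n. card (moved z) = 2 * k \<and> card (moved z') = 2 * k
    \<and> card (flipped n z) + card (flipped n z') \<le> k}"

lemma finite_few_flips: "finite (few_flips n k)"
  by (rule finite_subset[of _ "invols n \<times> invols n"]) (auto simp: few_flips_def finite_invols)

lemma card_few_flips_le:
  assumes k: "k > 0" and kn: "2 * k \<le> n"
  shows "real (card (few_flips n k)) \<le> (exp 2 * 2 * real n * sqrt (real n) / real k) ^ k"
proof -
  define a where "a = sqrt (real k / 2) / real n"
  define q where "q = sqrt (sqrt (real k / (2 * real n)))"
  have n: "real n > 0" using assms by auto
  have q2: "q\<^sup>2 = sqrt (real k / (2 * real n))" by (simp add: q_def)
  have q4: "q ^ 4 = real k / (2 * real n)"
  proof -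
    have "q ^ 4 = (q\<^sup>2)\<^sup>2" by simp
    then show ?thesis unfolding q2 by simp
  qed
  have a0: "a > 0" and q0: "q > 0" using k n by (simp_all add: a_def q_def)
  \<comment> \<open>Here \<open>2 * k \<le> n\<close> puts \<open>q\<close> into the range of
    \<open>invol_weight_bound\<close>.\<close>
  have "real k / (2 * real n) \<le> (1/2)\<^sup>2" using kn n by (simp add: field_simps power2_eq_square)
  then have q2le: "q\<^sup>2 \<le> 1/2" unfolding q2 by (intro real_le_lsqrt) auto
  have aq: "a * q\<^sup>2 = real k / (2 * real n * sqrt (real n))"
    unfolding a_def q2 using n by (simp add: real_sqrt_divide real_sqrt_mult field_simps)
  have aleq: "a \<le> q\<^sup>2"
  proof -
    have "a = sqrt (real k / (2 * real n)) / sqrt (real n)"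
      unfolding a_def using n by (simp add: real_sqrt_divide real_sqrt_mult field_simps)
    also have "\<dots> \<le> sqrt (real k / (2 * real n)) / 1"
      using n by (intro divide_left_mono) auto
    finally show ?thesis by (simp add: q2)
  qed
  define f where "f = (\<lambda>z. a ^ card (flipped n z) * q ^ (card (moved z) - 2 * card (flipped n z)))"
  have "real (card (few_flips n k)) * (a * q\<^sup>2) ^ k = (\<Sum>p\<in>few_flips n k. (a * q\<^sup>2) ^ k)" by simp
  also have "\<dots> \<le> (\<Sum>(z, z')\<in>few_flips n k. f z * f z')"
  proof (rule sum_mono, clarify)
    fix z z' assume p: "(z, z') \<in> few_flips n k"
    define j j' where "j = card (flipped n z)" and "j' = card (flipped n z')"
    have jk: "j + j' \<le> k" and m: "card (moved z) = 2 * k" "card (moved z') = 2 * k"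
      using p by (auto simp: few_flips_def j_def j'_def)
    have "f z * f z' = a ^ (j + j') * (q\<^sup>2) ^ (2 * k - j - j')"
      using jk by (simp add: f_def j_def[symmetric] j'_def[symmetric] m power_add[symmetric] power_mult[symmetric]
          diff_mult_distrib2[symmetric]) (simp add: algebra_simps power_add[symmetric])
    \<comment> \<open>At most \<open>k\<close> swaps leave at least \<open>k\<close> factors
      \<open>q\<^sup>2\<close>; those beyond \<open>k\<close> are lowered to
      \<open>a\<close>.\<close>
    also have "2 * k - j - j' = k + (k - (j + j'))" using jk by simp
    also have "a ^ (j + j') * (q\<^sup>2) ^ (k + (k - (j + j'))) \<ge> a ^ (j + j') * ((q\<^sup>2) ^ k * a ^ (k - (j + j')))"
      unfolding power_add using a0 aleq by (intro mult_left_mono power_mono) auto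
    also have "a ^ (j + j') * ((q\<^sup>2) ^ k * a ^ (k - (j + j'))) = (a * q\<^sup>2) ^ k"
      using jk by (simp add: power_mult_distrib power_add[symmetric] mult.left_commute)
    finally show "(a * q\<^sup>2) ^ k \<le> f z * f z'" .
  qed
  also have "\<dots> \<le> (\<Sum>(z, z')\<in>invols n \<times> invols n. f z * f z')"
    by (rule sum_mono2) (use a0 q0 in \<open>auto simp: finite_invols few_flips_def f_def\<close>)
  also have "\<dots> = (invol_weight n a q)\<^sup>2"
    by (simp add: sum.cartesian_product[symmetric] invol_weight_def f_def power2_eq_square sum_product)
  also have "\<dots> \<le> (exp (real k))\<^sup>2"
  proof (rule power_mono)
    have "invol_weight n a q \<le> exp (real n * (a / 2 + q ^ 4))"
      using invol_weight_bound[of a q n] a0 q0 q2le by simp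
    also have "real n * (a / 2 + q ^ 4) = sqrt (real k / 2) / 2 + real k / 2"
      using n by (simp add: a_def q4 field_simps)
    also have "\<dots> \<le> real k"
    proof -
      have "real k / 2 \<le> real k * real k" using k by (cases k) (auto simp: field_simps)
      then have "sqrt (real k / 2) \<le> real k" by (intro real_le_lsqrt) (auto simp: power2_eq_square)
      then show ?thesis by simp
    qed
    finally show "invol_weight n a q \<le> exp (real k)" by simp
    show "0 \<le> invol_weight n a q" unfolding invol_weight_def using a0 q0 by (intro sum_nonneg) auto
  qed
  also have "\<dots> = exp 2 ^ k" by (simp add: exp_of_nat_mult[symmetric] power2_eq_square exp_add[symmetric])
  finally have "real (card (few_flips n k)) \<le> exp 2 ^ k / (a * q\<^sup>2) ^ k"
    using a0 q0 by (simp add: field_simps)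
  also have "\<dots> = (exp 2 * 2 * real n * sqrt (real n) / real k) ^ k"
    unfolding aq power_divide[symmetric] by (simp add: field_simps)
  finally show ?thesis .
qed

text \<open>A pure counting condition: the pairs swapped by \<open>z\<close> and those swapped by
  its conjugate cover together at most as many points as \<open>z\<close> moves. With
  \<open>2 * k\<close> moved points this is the constraint in \<open>few_flips\<close>; its failure
  forces an overlap, as used in \<open>flipped_common_pair\<close>.\<close>

definition bad_conjugators :: "nat \<Rightarrow> (nat \<Rightarrow> nat) set"
  where "bad_conjugators n = {x. x permutes {1..n} \<and> (\<exists>z\<in>invols n. z \<noteq> id \<and> x \<circ> z \<circ> inv' x \<in> dyadic_group n
    \<and> 2 * card (flipped n z) + 2 * card (flipped n (x \<circ> z \<circ> inv' x)) \<le> card (moved z))}"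

lemma moved_conj:
  assumes x: "x permutes S"
  shows "moved (x \<circ> z \<circ> inv' x) = x ` moved z"
proof (rule Set.set_eqI)
  fix y
  obtain i where y: "y = x i" using surjD[OF permutes_surj[OF x]] by metis
  have "y \<in> moved (x \<circ> z \<circ> inv' x) \<longleftrightarrow> x (z i) \<noteq> x i" by (simp add: moved_def y permutes_inverses[OF x])
  also have "\<dots> \<longleftrightarrow> i \<in> moved z" using permutes_inj[OF x] by (simp add: moved_def inj_eq)
  also have "\<dots> \<longleftrightarrow> y \<in> x ` moved z" using permutes_inj[OF x] by (simp add: y inj_image_mem_iff)
  finally show "y \<in> moved (x \<circ> z \<circ> inv' x) \<longleftrightarrow> y \<in> x ` moved z" .
qed

lemma card_moved_conj: "x permutes S \<Longrightarrow> card (moved (x \<circ> z \<circ> inv' x)) = card (moved z)"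
  unfolding moved_conj by (rule card_image) (rule permutes_inj_on)

lemma conj_involution:
  assumes "x permutes S" "z \<circ> z = id"
  shows "(x \<circ> z \<circ> inv' x) \<circ> (x \<circ> z \<circ> inv' x) = id"
proof
  fix i
  have "z (z j) = j" for j using assms(2) by (simp add: fun_eq_iff)
  then show "((x \<circ> z \<circ> inv' x) \<circ> (x \<circ> z \<circ> inv' x)) i = id i"
    by (simp add: permutes_inverses[OF assms(1)])
qed

lemma bad_conjugators_subset:
  "bad_conjugators n \<subseteq> (\<Union>k\<in>{2..n div 2}. \<Union>(z, z')\<in>few_flips n k. {x. x permutes {1..n} \<and> x \<circ> z = z' \<circ> x})"
proof
  fix x assume "x \<in> bad_conjugators n"
  then obtain z where x: "x permutes {1..n}" and z: "z \<in> invols n" "z \<noteq> id"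
    and d: "x \<circ> z \<circ> inv' x \<in> dyadic_group n"
    and fl: "2 * card (flipped n z) + 2 * card (flipped n (x \<circ> z \<circ> inv' x)) \<le> card (moved z)"
    unfolding bad_conjugators_def by blast
  define z' where "z' = x \<circ> z \<circ> inv' x"
  have zz: "z \<circ> z = id" and zd: "z \<in> dyadic_group n" using z by (simp_all only: invols_def mem_Collect_eq)
  obtain k where k: "card (moved z) = 2 * k" using dyadic_group_card_moved(2)[OF zd] by (auto elim: evenE)
  have k': "card (moved z') = 2 * k" using card_moved_conj[OF x] k by (simp add: z'_def)
  have sub: "moved z \<subseteq> {1..n}" by (rule moved_permutes[OF invols_permutes[OF z(1)]])
  then have fin: "finite (moved z)" by (rule finite_subset) simp
  have "k \<noteq> 0" using z(2) k fin moved_empty_iff[of z] by auto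
  \<comment> \<open>For \<open>k = 1\<close> both \<open>z\<close> and \<open>z'\<close> swap one
    pair, which makes two swaps where only one is allowed. Starting the sum at 2 is what gives an
    error of order 1/n instead of 1/sqrt n.\<close>
  moreover have "k \<noteq> 1"
  proof
    assume "k = 1"
    then have "card (flipped n z) = 1" "card (flipped n z') = 1"
      using dyadic_group_card_moved(3) zd d k k' unfolding z'_def by simp_all
    then show False using fl k \<open>k = 1\<close> unfolding z'_def by simp
  qed
  moreover have "2 * k \<le> n" using card_mono[OF _ sub] k by simp
  ultimately have kr: "k \<in> {2..n div 2}" by auto
  have "z' \<in> invols n" unfolding invols_def z'_def using d conj_involution[OF x zz] by blast
  then have "(z, z') \<in> few_flips n k" using z k k' fl unfolding few_flips_def z'_def[symmetric] by auto
  moreover have "x \<circ> z = z' \<circ> x" by (simp add: z'_def fun_eq_iff permutes_inverses[OF x])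
  ultimately show "x \<in> (\<Union>k\<in>{2..n div 2}. \<Union>(z, z')\<in>few_flips n k. {x. x permutes {1..n} \<and> x \<circ> z = z' \<circ> x})"
    using kr x by blast
qed

lemma card_bad_conjugators_le:
  assumes n: "n > 0"
  shows "card (bad_conjugators n) / fact n \<le> 64 * exp 8 / real n"
proof -
  \<comment> \<open>The base of the k-th term of the first moment:
    \<open>exp 2 * 2 * n * sqrt n / k\<close> from the couples, times \<open>2 * k\<close> and
    \<open>(exp 1 / n)\<^sup>2\<close> from the matching probability.\<close>
  define y where "y = 4 * exp 4 / sqrt (real n)"
  define C where "C = (\<lambda>(z, z'). {x. x permutes {1..n} \<and> x \<circ> z = z' \<circ> x})"
  have y2: "y\<^sup>2 = 16 * exp 8 / real n"
  proof -
    have "exp (4::real) * exp 4 = exp 8" by (simp add: exp_add[symmetric])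
    then show ?thesis using n by (simp add: y_def power_divide power2_eq_square)
  qed
  have finp: "finite {x. x permutes {1..n}}" by (simp add: finite_permutations)
  have finC: "finite (C p)" for p
    by (rule finite_subset[OF _ finp]) (auto simp: C_def split: prod.splits)
  show ?thesis
  proof (cases "y \<le> 1/2")
    case False
    \<comment> \<open>For small \<open>n\<close> the trivial bound 1 is at most
      \<open>4 * y\<^sup>2\<close>; this case fixes the constant 64.\<close>
    have "card (bad_conjugators n) \<le> card {x. x permutes {1..n}}"
      by (rule card_mono[OF finp]) (auto simp: bad_conjugators_def)
    also have "\<dots> = fact n" by (rule card_permutations) auto
    finally have "card (bad_conjugators n) / fact n \<le> 1"
      using of_nat_mono[of "card (bad_conjugators n)" "fact n", where 'a = real] by (simp add: divide_le_eq_1)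
    also have "1 \<le> 4 * y\<^sup>2"
      using power_mono[of "1/2" y 2] False by (simp add: power2_eq_square)
    also have "\<dots> = 64 * exp 8 / real n" unfolding y2 by simp
    finally show ?thesis .
  next
    case True
    have bnd: "(\<Sum>p\<in>few_flips n k. real (card (C p))) / fact n \<le> y ^ k" if k: "k \<in> {2..n div 2}" for k
    proof -
      have kn: "2 * k \<le> n" "k > 0" using k by auto
      have "(\<Sum>p\<in>few_flips n k. real (card (C p))) \<le> (\<Sum>p\<in>few_flips n k. real ((2 * k) ^ k * fact (n - 2 * k)))"
      proof (rule sum_mono, clarify)
        fix z z' assume p: "(z, z') \<in> few_flips n k"
        then have "z \<in> invols n" "z' \<in> invols n" "card (moved z) = 2 * k" "card (moved z') = 2 * k"
          by (auto simp: few_flips_def)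
        then have "card (C (z, z')) \<le> (2 * k) ^ k * fact (n - 2 * k)"
          unfolding C_def prod.case
          by (intro card_conjugators_le) (auto simp only: invols_permutes, simp only: invols_def mem_Collect_eq)
        then show "real (card (C (z, z'))) \<le> real ((2 * k) ^ k * fact (n - 2 * k))" by (rule of_nat_mono)
      qed
      also have "\<dots> = real (card (few_flips n k)) * ((2 * real k) ^ k * fact (n - 2 * k))" by simp
      finally have "(\<Sum>p\<in>few_flips n k. real (card (C p))) / fact n
          \<le> real (card (few_flips n k)) * (2 * real k) ^ k * (fact (n - 2 * k) / fact n)"
        by (simp add: divide_right_mono mult.assoc)
      also have "\<dots> \<le> (exp 2 * 2 * real n * sqrt (real n) / real k) ^ k * (2 * real k) ^ k * (exp 1 / real n) ^ (2 * k)"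
        by (intro mult_mono card_few_flips_le fact_diff_ratio_le kn mult_nonneg_nonneg) auto
      also have "\<dots> = (exp 2 * 2 * real n * sqrt (real n) / real k * (2 * real k) * (exp 1 / real n)\<^sup>2) ^ k"
        by (simp only: power_mult power_mult_distrib[symmetric])
      also have "exp 2 * 2 * real n * sqrt (real n) / real k * (2 * real k) * (exp 1 / real n)\<^sup>2 = y"
      proof -
        have "exp (2::real) * (exp 1)\<^sup>2 = exp 4" by (simp add: power2_eq_square exp_add[symmetric])
        moreover have "exp 2 * 2 * real n * sqrt (real n) / real k * (2 * real k) * (exp 1 / real n)\<^sup>2
            = 4 * (exp 2 * (exp 1)\<^sup>2) * (sqrt (real n) / real n)"
          using n kn(2) by (simp add: power2_eq_square field_simps)
        moreover have "sqrt (real n) / real n = 1 / sqrt (real n)"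
          using n by (simp add: field_simps)
        ultimately show ?thesis by (simp add: y_def)
      qed
      finally show ?thesis .
    qed
    have "card (bad_conjugators n) \<le> card (\<Union>k\<in>{2..n div 2}. \<Union>p\<in>few_flips n k. C p)"
    proof (rule card_mono)
      show "finite (\<Union>k\<in>{2..n div 2}. \<Union>p\<in>few_flips n k. C p)" using finite_few_flips finC by blast
      show "bad_conjugators n \<subseteq> (\<Union>k\<in>{2..n div 2}. \<Union>p\<in>few_flips n k. C p)"
        using bad_conjugators_subset[of n] unfolding C_def .
    qed
    also have "\<dots> \<le> (\<Sum>k\<in>{2..n div 2}. card (\<Union>p\<in>few_flips n k. C p))" by (rule card_UN_le) simp
    also have "\<dots> \<le> (\<Sum>k\<in>{2..n div 2}. \<Sum>p\<in>few_flips n k. card (C p))"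
      by (intro sum_mono card_UN_le finite_few_flips)
    finally have "real (card (bad_conjugators n)) \<le> real (\<Sum>k\<in>{2..n div 2}. \<Sum>p\<in>few_flips n k. card (C p))"
      by (rule of_nat_mono)
    then have "card (bad_conjugators n) / fact n \<le> (\<Sum>k\<in>{2..n div 2}. (\<Sum>p\<in>few_flips n k. real (card (C p))) / fact n)"
      by (simp add: sum_divide_distrib[symmetric] divide_right_mono)
    also have "\<dots> \<le> (\<Sum>k\<in>{2..n div 2}. y ^ k)" by (intro sum_mono bnd)
    also have "\<dots> \<le> 2 * y\<^sup>2" by (rule sum_power_from_2_le) (use True in \<open>auto simp: y_def\<close>)
    also have "\<dots> \<le> 64 * exp 8 / real n" unfolding y2 by (simp add: divide_right_mono)
    finally show ?thesis .
  qed
qed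

section \<open>Common edges of two random matchings\<close>

definition pair :: "nat \<Rightarrow> nat set"
  where "pair i = {2 * i - 1, 2 * i}"

definition common_pairs :: "nat \<Rightarrow> (nat \<Rightarrow> nat) \<Rightarrow> nat set"
  where "common_pairs n x = {i \<in> {1..n div 2}. x ` pair i \<in> pair ` {1..n div 2}}"

lemma pair_eq_half_vimage: "i \<ge> 1 \<Longrightarrow> pair i = half -` {i}"
  unfolding pair_def half_def by auto

lemma pairs_disjoint_doubletons:
  "i \<in> {1..n div 2} \<Longrightarrow> card (pair i) = 2 \<and> pair i \<subseteq> {1..n}"
  "inj_on pair {1..n div 2}"
  "i \<in> {1..n div 2} \<Longrightarrow> i' \<in> {1..n div 2} \<Longrightarrow> i \<noteq> i' \<Longrightarrow> pair i \<inter> pair i' = {}"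
proof -
  assume "i \<in> {1..n div 2}"
  then have "1 \<le> i" "2 * i \<le> n" by auto
  then show "card (pair i) = 2 \<and> pair i \<subseteq> {1..n}" by (auto simp: pair_def)
next
  show "inj_on pair {1..n div 2}"
  proof (rule inj_onI)
    fix i j assume ij: "i \<in> {1..n div 2}" "j \<in> {1..n div 2}" "pair i = pair j"
    then have "Max (pair i) = Max (pair j)" by simp
    then show "i = j" using ij(1,2) by (simp add: pair_def)
  qed
next
  assume "i \<in> {1..n div 2}" "i' \<in> {1..n div 2}" "i \<noteq> i'"
  then show "pair i \<inter> pair i' = {}" by (auto simp: pair_eq_half_vimage)
qed

text \<open>An instance of \<open>card_bij_funs_pairs\<close> with the pairs of \<open>S\<close> as
  source edges and all pairs as target edges.\<close>

lemma card_common_pairs_superset: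
  assumes S: "S \<subseteq> {1..n div 2}"
  shows "card {x. x permutes {1..n} \<and> S \<subseteq> common_pairs n x}
    = (\<Prod>i<card S. 2 * (n div 2 - i)) * fact (n - 2 * card S)"
proof -
  define h where "h = (\<lambda>p :: nat \<Rightarrow> nat. restrict p {1..n})"
  define \<T> where "\<T> = pair ` {1..n div 2}"
  have bij: "bij_betw h {p. p permutes {1..n}} (bij_funs {1..n} {1..n})"
    unfolding h_def by (rule bij_betw_restrict_permutes)
  have iff: "S \<subseteq> common_pairs n x \<longleftrightarrow> (\<forall>e\<in>pair ` S. h x ` e \<in> \<T>)" for x
  proof -
    have "h x ` pair i = x ` pair i" if "i \<in> S" for i
    proof -
      have "pair i \<subseteq> {1..n}" using pairs_disjoint_doubletons(1) S that by blast
      then show ?thesis unfolding h_def by (intro image_cong refl restrict_apply') blast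
    qed
    then show ?thesis using S unfolding common_pairs_def \<T>_def by auto
  qed
  have img: "h ` {x. x permutes {1..n} \<and> S \<subseteq> common_pairs n x} = {f \<in> bij_funs {1..n} {1..n}. \<forall>e\<in>pair ` S. f ` e \<in> \<T>}"
    unfolding iff using bij by (auto simp: bij_betw_def)
  have inj: "inj_on h {x. x permutes {1..n} \<and> S \<subseteq> common_pairs n x}"
    using bij by (auto simp: bij_betw_def intro: inj_on_subset)
  have "card {x. x permutes {1..n} \<and> S \<subseteq> common_pairs n x}
      = card {f \<in> bij_funs {1..n} {1..n}. \<forall>e\<in>pair ` S. f ` e \<in> \<T>}"
    using card_image[OF inj] unfolding img by (rule sym)
  also have "\<dots> = (\<Prod>i<card (pair ` S). 2 * (card \<T> - i)) * fact (n - 2 * card (pair ` S))"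
  proof (rule card_bij_funs_pairs)
    show "finite (pair ` S)" using S by (simp add: finite_subset)
    show "card e = 2 \<and> e \<subseteq> {1..n}" if "e \<in> pair ` S" for e using that S pairs_disjoint_doubletons(1) by blast
    show "e \<inter> e' = {}" if "e \<in> pair ` S" "e' \<in> pair ` S" "e \<noteq> e'" for e e'
      using that S pairs_disjoint_doubletons(3) by blast
    show "card e = 2 \<and> e \<subseteq> {1..n}" if "e \<in> \<T>" for e using that pairs_disjoint_doubletons(1) unfolding \<T>_def by blast
    show "e \<inter> e' = {}" if "e \<in> \<T>" "e' \<in> \<T>" "e \<noteq> e'" for e e'
      using that pairs_disjoint_doubletons(3) unfolding \<T>_def by blast
  qed (auto simp: \<T>_def)
  also have "card (pair ` S) = card S" using pairs_disjoint_doubletons(2) S by (intro card_image) (auto intro: inj_on_subset)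
  also have "card \<T> = n div 2" unfolding \<T>_def using pairs_disjoint_doubletons(2) by (simp add: card_image)
  finally show ?thesis .
qed

lemma sum_Pow_card:
  fixes h :: "nat \<Rightarrow> 'a::comm_semiring_1"
  assumes "finite A"
  shows "(\<Sum>S\<in>Pow A. h (card S)) = (\<Sum>j\<le>card A. of_nat (card A choose j) * h j)"
proof -
  have "(\<Sum>S\<in>Pow A. h (card S)) = (\<Sum>j\<in>{..card A}. \<Sum>S | S \<in> Pow A \<and> card S = j. h (card S))"
    by (rule sum.group[symmetric]) (use assms in \<open>auto intro: card_mono\<close>)
  also have "\<dots> = (\<Sum>j\<le>card A. of_nat (card A choose j) * h j)"
    using n_subsets[OF assms] by (intro sum.cong refl) simp
  finally show ?thesis .
qed

text \<open>The expected number of \<open>j\<close>-element subsets of \<open>common_pairs n x\<close> for random \<open>x\<close>.\<close>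

definition matching_moment :: "nat \<Rightarrow> nat \<Rightarrow> real"
  where "matching_moment n j = real ((n div 2) choose j) * real ((\<Prod>i<j. 2 * (n div 2 - i)) * fact (n - 2 * j)) / fact n"

text \<open>Double counting of x together with a subset \<open>S\<close> of its common pairs. The
  weight \<open>\<phi>\<close> stays general so that the events of no common pair and of exactly one
  are both covered.\<close>

lemma inclusion_exclusion_common_pairs:
  fixes \<phi> :: "nat \<Rightarrow> real"
  shows "(\<Sum>x | x permutes {1..n}. \<Sum>S\<in>Pow (common_pairs n x). \<phi> (card S)) / fact n
    = (\<Sum>j\<le>n div 2. \<phi> j * matching_moment n j)"
proof -
  define P where "P = {x. x permutes {1..n}}"
  have finP: "finite P" unfolding P_def by (rule finite_permutations) simp
  have "(\<Sum>x\<in>P. \<Sum>S\<in>Pow (common_pairs n x). \<phi> (card S))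
      = (\<Sum>x\<in>P. \<Sum>S\<in>{S \<in> Pow {1..n div 2}. S \<subseteq> common_pairs n x}. \<phi> (card S))"
    by (intro sum.cong refl) (auto simp: common_pairs_def)
  also have "\<dots> = (\<Sum>S\<in>Pow {1..n div 2}. \<Sum>x\<in>{x \<in> P. S \<subseteq> common_pairs n x}. \<phi> (card S))"
    by (rule sum.swap_restrict) (use finP in auto)
  also have "\<dots> = (\<Sum>S\<in>Pow {1..n div 2}. \<phi> (card S) * real ((\<Prod>i<card S. 2 * (n div 2 - i)) * fact (n - 2 * card S)))"
  proof (rule sum.cong[OF refl])
    fix S assume "S \<in> Pow {1..n div 2}"
    then have "card {x \<in> P. S \<subseteq> common_pairs n x} = (\<Prod>i<card S. 2 * (n div 2 - i)) * fact (n - 2 * card S)"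
      using card_common_pairs_superset[of S n] by (simp only: P_def Pow_iff mem_Collect_eq)
    then show "(\<Sum>x\<in>{x \<in> P. S \<subseteq> common_pairs n x}. \<phi> (card S))
        = \<phi> (card S) * real ((\<Prod>i<card S. 2 * (n div 2 - i)) * fact (n - 2 * card S))"
      by (simp only: sum_constant mult.commute)
  qed
  also have "\<dots> = (\<Sum>j\<le>n div 2. real (n div 2 choose j) * (\<phi> j * real ((\<Prod>i<j. 2 * (n div 2 - i)) * fact (n - 2 * j))))"
    by (subst sum_Pow_card) auto
  finally show ?thesis
    unfolding P_def matching_moment_def by (simp only: sum_divide_distrib) (simp add: mult_ac)
qed

text \<open>Consecutive values of \<open>2 ^ j * fact j * matching_moment n j\<close> have a
  quotient between d/(d+1) and (d+1)/d, where d = m - j. The products of these bounds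
  telescope.\<close>

lemma matching_moment_bounds:
  assumes "j \<le> n div 2"
  defines "m \<equiv> real (n div 2)" 
  shows "(m - j + 1) / (m + 1) \<le> 2 ^ j * fact j * matching_moment n j
    \<and> 2 ^ j * fact j * matching_moment n j \<le> (m + 1) / (m - j + 1)"
  using assms(1)
proof (induction j)
  case 0
  then show ?case by (simp add: matching_moment_def m_def)
next
  case (Suc j)
  define M where "M = n div 2"
  define d where "d = m - real j"
  define T where "T = (\<lambda>j. 2 ^ j * fact j * matching_moment n j)"
  have jM: "j < M" using Suc.prems by (simp add: M_def)
  have d1: "d \<ge> 1" using jM by (simp add: d_def m_def M_def)
  have Md: "real (M - j) = d" using jM by (simp add: d_def m_def M_def)
  \<comment> \<open>After \<open>j\<close> edges \<open>r + 2\<close> points remain; the two cases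
    are the parities of \<open>n\<close>.\<close>
  obtain r where r: "n - 2 * j = Suc (Suc r)" "n - 2 * Suc j = r" "real r + 2 = 2 * d \<or> real r + 2 = 2 * d + 1"
  proof
    have "2 * M = n \<or> 2 * M + 1 = n" unfolding M_def by presburger
    then have "real n = 2 * m \<or> real n = 2 * m + 1" by (auto simp: m_def M_def[symmetric])
    moreover have nj: "2 * Suc j \<le> n" using jM unfolding M_def by presburger
    ultimately show "real (n - 2 * Suc j) + 2 = 2 * d \<or> real (n - 2 * Suc j) + 2 = 2 * d + 1"
      by (auto simp: d_def)
    show "n - 2 * j = Suc (Suc (n - 2 * Suc j))" using nj by arith
  qed simp
  have ch: "real (M choose Suc j) * (real j + 1) = real (M choose j) * d"
  proof -
    have "(M choose Suc j) * Suc j = (M choose j) * (M - j)" 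
      unfolding mult.commute[of _ "Suc j"] mult.commute[of _ "M - j"]
      by (simp only: binomial_absorb_comp binomial_absorption)
    then have "real ((M choose Suc j) * Suc j) = real ((M choose j) * (M - j))" by simp
    then show ?thesis by (simp only: of_nat_mult of_nat_Suc Md add.commute)
  qed
  define p where "p = real (\<Prod>i<j. 2 * (M - i))"
  define D where "D = (real r + 2) * (real r + 1)"
  have D: "D > 0" unfolding D_def by simp
  have step: "T (Suc j) = T j * (4 * d\<^sup>2 / D)"
  proof -
    have fj: "(fact (Suc j) :: real) = (real j + 1) * fact j" by (simp add: algebra_simps)
    have fr: "(fact (Suc (Suc r)) :: real) = D * fact r" by (simp add: D_def algebra_simps)
    have pS: "real (\<Prod>i<Suc j. 2 * (M - i)) = p * (2 * d)"
      by (simp only: prod.lessThan_Suc of_nat_mult Md of_nat_numeral p_def)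
    have "T (Suc j) = 2 * 2 ^ j * ((real j + 1) * fact j) * (real (M choose Suc j) * (p * (2 * d) * fact r) / fact n)"
      unfolding T_def matching_moment_def r(2) M_def[symmetric] by (simp only: of_nat_mult of_nat_fact pS fj power_Suc)
    also have "\<dots> = 2 * 2 ^ j * fact j * (real (M choose Suc j) * (real j + 1)) * (p * (2 * d) * fact r) / fact n"
      by (simp add: mult_ac)
    also have "\<dots> = 2 ^ j * fact j * real (M choose j) * p * (4 * d\<^sup>2) * fact r / fact n"
      unfolding ch by (simp add: power2_eq_square)
    also have "\<dots> = 2 ^ j * fact j * (real (M choose j) * (p * (D * fact r)) / fact n) * (4 * d\<^sup>2 / D)"
      using D by simp
    also have "2 ^ j * fact j * (real (M choose j) * (p * (D * fact r)) / fact n) = T j"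
      unfolding T_def matching_moment_def r(1) M_def[symmetric] p_def
      by (simp only: of_nat_mult of_nat_fact fr)
    finally show ?thesis .
  qed
  have Tj: "(d + 1) / (m + 1) \<le> T j" "T j \<le> (m + 1) / (d + 1)"
    using Suc.IH Suc.prems by (simp_all add: T_def d_def)
  have m0: "m \<ge> 0" by (simp add: m_def)
  define c where "c = 4 * d\<^sup>2 / D"
  have frac_le: "x / y \<le> u / v" if "x * v \<le> u * y" "y > 0" "v > 0" for x y u v :: real
    using that by (simp add: field_simps)
  \<comment> \<open>The quotient \<open>c\<close> is 2d/(2d-1) for even \<open>n\<close> and
    2d/(2d+1) for odd \<open>n\<close>.\<close>
  have c: "d / (d + 1) \<le> c \<and> c \<le> (d + 1) / d"
    using r(3)
  proof
    assume "real r + 2 = 2 * d"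
    then have rr: "real r + 2 = 2 * d" "real r + 1 = 2 * d - 1" by auto
    have "c = 2 * d / (2 * d - 1)" unfolding c_def D_def rr
      by (subst frac_eq_eq) (use d1 in \<open>auto simp: power2_eq_square algebra_simps\<close>)
    moreover have "d / (d + 1) \<le> 2 * d / (2 * d - 1)" "2 * d / (2 * d - 1) \<le> (d + 1) / d"
      by (rule frac_le; use d1 in \<open>simp add: algebra_simps\<close>)+
    ultimately show ?thesis by simp
  next
    assume "real r + 2 = 2 * d + 1"
    then have rr: "real r + 2 = 2 * d + 1" "real r + 1 = 2 * d" by auto
    have "c = 2 * d / (2 * d + 1)" unfolding c_def D_def rr
    proof (subst frac_eq_eq)
      show "(2 * d + 1) * (2 * d) \<noteq> 0" "2 * d + 1 \<noteq> 0" using d1 by auto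
    qed (simp add: power2_eq_square algebra_simps)
    moreover have "d / (d + 1) \<le> 2 * d / (2 * d + 1)" "2 * d / (2 * d + 1) \<le> (d + 1) / d"
      by (rule frac_le; use d1 in \<open>simp add: algebra_simps\<close>)+
    ultimately show ?thesis by simp
  qed
  have "d / (m + 1) = (d + 1) / (m + 1) * (d / (d + 1))" using d1 by simp
  also have "\<dots> \<le> T j * c" using Tj c d1 m0 by (intro mult_mono) (auto intro: order_trans[rotated])
  finally have lo: "d / (m + 1) \<le> T (Suc j)" by (simp add: step c_def)
  have "0 \<le> c" using c d1 by (auto intro: order_trans[rotated])
  then have "T j * c \<le> (m + 1) / (d + 1) * ((d + 1) / d)" using Tj c d1 m0 by (intro mult_mono) auto
  also have "\<dots> = (m + 1) / d" using d1 by simp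
  finally have "T (Suc j) \<le> (m + 1) / d" by (simp add: step c_def)
  with lo show ?case by (simp add: T_def d_def)
qed

text \<open>\<open>1 / (2 ^ j * fact j)\<close> is the j-th binomial moment of the Poisson law with
  mean 1/2. Beyond \<open>n div 2\<close> the moment counts as 0, and the bound holds since the
  relative error allowed there is at least 1.\<close>

lemma matching_moment_approx:
  assumes m: "n div 2 > 0"
  shows "\<bar>(if j \<le> n div 2 then matching_moment n j else 0) - 1 / (2 ^ j * fact j)\<bar>
    \<le> (real j)\<^sup>2 / real (n div 2) / (2 ^ j * fact j)"
proof (cases "j \<le> n div 2")
  case False
  then have "real (n div 2) \<le> real j" "real j \<ge> 1" using m by auto
  then have "real (n div 2) \<le> (real j)\<^sup>2"
    using mult_mono[of 1 "real j" "real (n div 2)" "real j"] by (simp add: power2_eq_square)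
  then have "1 \<le> (real j)\<^sup>2 / real (n div 2)" using m by (simp add: field_simps)
  then have "1 / (2 ^ j * fact j) \<le> (real j)\<^sup>2 / real (n div 2) / (2 ^ j * fact j)" by (rule divide_right_mono) simp
  then show ?thesis using False by (simp del: divide_divide_eq_left)
next
  case True
  define M where "M = real (n div 2)"
  define x where "x = 2 ^ j * fact j * matching_moment n j"
  have M: "M > 0" "real j \<le> M" using m True by (simp_all add: M_def)
  have b: "(M - j + 1) / (M + 1) \<le> x" "x \<le> (M + 1) / (M - j + 1)"
    using matching_moment_bounds[OF True] by (simp_all add: M_def x_def)
  have "\<bar>x - 1\<bar> \<le> (real j)\<^sup>2 / M"
  proof (cases "j = 0")
    case True
    then show ?thesis using b M by simp
  next
    case False
    then have j1: "real j \<ge> 1" by simp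
    have "(real j - 1) * (M - real j) \<ge> 0" using j1 M by (intro mult_nonneg_nonneg) auto
    then have "M \<le> real j * (M - j + 1)" by (simp add: algebra_simps)
    then have "real j * M \<le> real j * (real j * (M - j + 1))" using j1 by (intro mult_left_mono) auto
    then have k: "real j / (M - j + 1) \<le> (real j)\<^sup>2 / M"
      using M by (simp add: pos_divide_le_eq pos_le_divide_eq power2_eq_square mult_ac)
    have "x - 1 \<le> real j / (M - j + 1)" using b(2) M by (simp add: field_simps)
    moreover have "1 - x \<le> real j / (M + 1)" using b(1) M by (simp add: field_simps)
    moreover have "real j / (M + 1) \<le> real j / (M - j + 1)" using M by (intro divide_left_mono) auto
    ultimately show ?thesis using k by linarith
  qed
  then have "\<bar>x - 1\<bar> / (2 ^ j * fact j) \<le> (real j)\<^sup>2 / M / (2 ^ j * fact j)" by (rule divide_right_mono) simp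
  moreover have "matching_moment n j - 1 / (2 ^ j * fact j) = (x - 1) / (2 ^ j * fact j)"
    by (simp add: x_def field_simps)
  ultimately show ?thesis using True by (simp add: M_def abs_divide)
qed

text \<open>From \<open>(j + 1) * j\<^sup>2 \<le> 6 * exp (1 + j)\<close>, the summed error is at
  most \<open>6 * exp 1\<close> times the exponential series at \<open>exp 1 / 2\<close>, divided by
  \<open>n div 2\<close>.\<close>

definition moment_const :: real
  where "moment_const = 6 * exp 1 * exp (exp 1 / 2)"

lemma moment_sum_approx:
  fixes \<phi> :: "nat \<Rightarrow> real"
  assumes m: "n div 2 > 0" and \<phi>: "\<And>j. \<bar>\<phi> j\<bar> \<le> real j + 1"
    and s: "(\<lambda>j. \<phi> j / (2 ^ j * fact j)) sums s"
  shows "\<bar>(\<Sum>j\<le>n div 2. \<phi> j * matching_moment n j) - s\<bar> \<le> moment_const / real (n div 2)"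
proof -
  \<comment> \<open>Extending the finite sum by zeros allows a termwise comparison with the series
    for \<open>s\<close>; the tail needs no separate estimate.\<close>
  define g where "g = (\<lambda>j. \<phi> j * (if j \<le> n div 2 then matching_moment n j else 0))"
  define h where "h = (\<lambda>j. g j - \<phi> j / (2 ^ j * fact j))"
  define B where "B = (\<lambda>j. (exp 1 / 2) ^ j /\<^sub>R fact j * (6 * exp 1 / real (n div 2)))"
  have "g sums (\<Sum>j\<in>{..n div 2}. g j)" by (rule sums_finite) (auto simp: g_def)
  moreover have "(\<Sum>j\<in>{..n div 2}. g j) = (\<Sum>j\<le>n div 2. \<phi> j * matching_moment n j)"
    by (rule sum.cong) (auto simp: g_def)
  ultimately have h: "h sums ((\<Sum>j\<le>n div 2. \<phi> j * matching_moment n j) - s)"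
    unfolding h_def using s by (intro sums_diff) auto
  have B: "B sums (exp (exp 1 / 2) * (6 * exp 1 / real (n div 2)))"
    unfolding B_def by (intro sums_mult2 exp_converges)
  have hB: "\<bar>h j\<bar> \<le> B j" for j
  proof -
    have "\<bar>h j\<bar> = \<bar>\<phi> j\<bar> * \<bar>(if j \<le> n div 2 then matching_moment n j else 0) - 1 / (2 ^ j * fact j)\<bar>"
      unfolding h_def g_def abs_mult[symmetric] by (simp add: right_diff_distrib)
    also have "\<dots> \<le> (real j + 1) * ((real j)\<^sup>2 / real (n div 2) / (2 ^ j * fact j))"
      by (intro mult_mono \<phi> matching_moment_approx m) auto
    also have "\<dots> = (real j + 1) * (real j)\<^sup>2 * (1 / (real (n div 2) * 2 ^ j * fact j))" by simp
    also have "\<dots> \<le> (6 * exp 1 * exp 1 ^ j) * (1 / (real (n div 2) * 2 ^ j * fact j))"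
    proof (rule mult_right_mono)
      have "(real j + 1) * (real j)\<^sup>2 \<le> (real j + 1) * (real j + 1)\<^sup>2"
        by (intro mult_left_mono power_mono) auto
      also have "\<dots> = (1 + real j) ^ 3" by (simp add: power3_eq_cube power2_eq_square algebra_simps)
      also have "\<dots> \<le> exp (1 + real j) * fact 3" by (rule power_le_exp_fact) simp
      also have "\<dots> = 6 * exp 1 * exp 1 ^ j"
        by (simp add: exp_add exp_of_nat_mult[symmetric] fact_numeral)
      finally show "(real j + 1) * (real j)\<^sup>2 \<le> 6 * exp 1 * exp 1 ^ j" .
    qed simp
    also have "\<dots> = B j" by (simp add: B_def power_divide inverse_eq_divide mult_ac)
    finally show ?thesis .
  qed
  have sum_B: "summable B" using B by (rule sums_summable)
  have "summable (\<lambda>j. \<bar>h j\<bar>)" by (rule summable_comparison_test'[OF sum_B]) (use hB in auto)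
  then have "\<bar>suminf h\<bar> \<le> suminf (\<lambda>j. \<bar>h j\<bar>)" by (rule summable_rabs)
  also have "\<dots> \<le> suminf B" by (rule suminf_le[OF hB \<open>summable (\<lambda>j. \<bar>h j\<bar>)\<close> sum_B])
  finally show ?thesis
    using sums_unique[OF h] sums_unique[OF B] by (simp add: moment_const_def mult_ac)
qed

section \<open>Poisson probabilities of no common pair and of exactly one\<close>

lemma sums_exp_minus_half: "(\<lambda>j. (- 1) ^ j / (2 ^ j * fact j)) sums exp (- 1 / 2 :: real)"
proof -
  have "(- 1 / 2 :: real) ^ j /\<^sub>R fact j = (- 1) ^ j / (2 ^ j * fact j)" for j
    by (simp only: power_divide) (simp add: field_simps)
  then show ?thesis using exp_converges[of "- 1 / 2 :: real"] by simp
qed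

text \<open>The term at 0 vanishes, and the shift by one index cancels the factor \<open>j\<close>
  and leaves half of the previous series.\<close>

lemma sums_half_exp_minus_half:
  "(\<lambda>j. - ((- 1) ^ j * real j) / (2 ^ j * fact j)) sums (exp (- 1 / 2) / 2)"
proof -
  have "(\<lambda>j. - ((- 1) ^ Suc j * real (Suc j)) / (2 ^ Suc j * fact (Suc j))) = (\<lambda>j. (- 1) ^ j / (2 ^ j * fact j) / (2 :: real))"
  proof
    fix j
    have "(fact (Suc j) :: real) = real (Suc j) * fact j" by simp
    then show "- ((- 1) ^ Suc j * real (Suc j)) / (2 ^ Suc j * fact (Suc j)) = (- 1) ^ j / (2 ^ j * fact j) / (2 :: real)"
      by (simp del: fact_Suc of_nat_Suc)
  qed
  then have "(\<lambda>j. - ((- 1) ^ Suc j * real (Suc j)) / (2 ^ Suc j * fact (Suc j))) sums (exp (- 1 / 2) / 2)"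
    using sums_divide[OF sums_exp_minus_half, of 2] by simp
  then show ?thesis by (subst (asm) sums_Suc_iff) simp
qed

lemma sum_Pow_alternating:
  fixes C :: "nat set"
  assumes "finite C"
  shows "(\<Sum>S\<in>Pow C. (- 1 :: real) ^ card S) = of_bool (C = {})"
  using sum_Pow_power_card[OF assms, of "- 1 :: real"] assms by (simp add: card_gt_0_iff)

text \<open>The derivative of (1 + t)^(card C) at t = -1. In the induction, subsets with and without
  the new element cancel except for an alternating sum that tests whether the rest is empty.\<close>

lemma sum_Pow_alternating_card:
  fixes C :: "nat set"
  assumes "finite C"
  shows "(\<Sum>S\<in>Pow C. - ((- 1 :: real) ^ card S * real (card S))) = of_bool (card C = 1)"
    using assms
  proof (induction C)
    case empty
    then show ?case by simp
  next
    case (insert a C)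
    let ?f = "\<lambda>S :: nat set. - ((- 1 :: real) ^ card S * real (card S))"
    have "(\<Sum>S\<in>Pow (insert a C). ?f S) = (\<Sum>S\<in>Pow C. ?f S) + (\<Sum>S\<in>insert a ` Pow C. ?f S)"
      unfolding Pow_insert using insert by (intro sum.union_disjoint) auto
    also have "(\<Sum>S\<in>insert a ` Pow C. ?f S) = (\<Sum>S\<in>Pow C. ?f (insert a S))"
      using insert.hyps by (subst sum.reindex) (auto simp: inj_on_def)
    also have "\<dots> = (\<Sum>S\<in>Pow C. (- 1) ^ card S - ?f S)"
    proof (rule sum.cong[OF refl])
      fix S assume "S \<in> Pow C"
      then have "finite S" "a \<notin> S" using insert.hyps by (auto intro: finite_subset)
      then show "?f (insert a S) = (- 1) ^ card S - ?f S" by (simp add: algebra_simps)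
    qed
    also have "\<dots> = of_bool (C = {}) - (\<Sum>S\<in>Pow C. ?f S)" using sum_Pow_alternating[OF insert.hyps(1)] by (simp only: sum_subtractf)
    finally show ?case using insert.hyps by simp
  qed

lemma finite_common_pairs: "finite (common_pairs n x)"
  unfolding common_pairs_def by simp

lemma card_no_common_pairs:
  assumes "n div 2 > 0"
  shows "\<bar>card {x. x permutes {1..n} \<and> common_pairs n x = {}} / fact n - exp (- 1 / 2)\<bar>
    \<le> moment_const / real (n div 2)"
proof -
  have "card {x. x permutes {1..n} \<and> common_pairs n x = {}}
      = (\<Sum>x | x permutes {1..n}. of_bool (common_pairs n x = {}))"
    using finite_permutations[of "{1..n}"] by (simp add: of_bool_def sum.If_cases Int_def)
  then have "real (card {x. x permutes {1..n} \<and> common_pairs n x = {}}) / fact n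
      = (\<Sum>x | x permutes {1..n}. \<Sum>S\<in>Pow (common_pairs n x). (- 1) ^ card S) / fact n"
    by (simp only: sum_Pow_alternating[OF finite_common_pairs] of_nat_sum of_nat_of_bool)
  also have "\<dots> = (\<Sum>j\<le>n div 2. (- 1) ^ j * matching_moment n j)"
    by (rule inclusion_exclusion_common_pairs)
  finally show ?thesis
    using moment_sum_approx[OF assms _ sums_exp_minus_half] by (simp add: power_abs)
qed

lemma card_one_common_pair:
  assumes "n div 2 > 0"
  shows "\<bar>card {x. x permutes {1..n} \<and> card (common_pairs n x) = 1} / fact n - exp (- 1 / 2) / 2\<bar>
    \<le> moment_const / real (n div 2)"
proof -
  have "card {x. x permutes {1..n} \<and> card (common_pairs n x) = 1}
      = (\<Sum>x | x permutes {1..n}. of_bool (card (common_pairs n x) = 1))"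
    using finite_permutations[of "{1..n}"] by (simp add: of_bool_def sum.If_cases Int_def)
  then have "real (card {x. x permutes {1..n} \<and> card (common_pairs n x) = 1}) / fact n
      = (\<Sum>x | x permutes {1..n}. \<Sum>S\<in>Pow (common_pairs n x). - ((- 1) ^ card S * real (card S))) / fact n"
    by (simp only: sum_Pow_alternating_card[OF finite_common_pairs] of_nat_sum of_nat_of_bool)
  also have "\<dots> = (\<Sum>j\<le>n div 2. - ((- 1) ^ j * real j) * matching_moment n j)"
    by (rule inclusion_exclusion_common_pairs)
  finally show ?thesis
    using moment_sum_approx[OF assms _ sums_half_exp_minus_half] by (simp add: power_abs abs_mult)
qed

section \<open>Trivial intersections\<close>

definition pair_swap :: "nat \<Rightarrow> nat \<Rightarrow> nat"
  where "pair_swap i = Transposition.transpose (2 * i - 1) (2 * i)"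

lemma pair_swap_eq_lift:
  assumes "i \<ge> 1"
  shows "pair_swap i = lift id {i}"
proof
  fix x
  have i: "half (2 * i - 1) = i" "half (2 * i) = i" "odd (2 * i - 1)" using assms half_simps by simp_all
  have sub: "id permutes {1..i}" "{i} \<subseteq> {1..i}" using assms by (simp_all add: permutes_id)
  show "pair_swap i x = lift id {i} x"
  proof (rule half_odd_eqI)
    consider "x = 2 * i - 1" | "x = 2 * i" | "half x \<noteq> i" "x \<noteq> 2 * i - 1" "x \<noteq> 2 * i"
      using half_odd_eqI[of x "2 * i"] half_odd_eqI[of x "2 * i - 1"] i by fastforce
    then have "half (pair_swap i x) = half x \<and> odd (pair_swap i x) = (odd x \<noteq> (half x = i))"
      using i by cases (auto simp: pair_swap_def Transposition.transpose_def)
    then show "half (pair_swap i x) = half (lift id {i} x)" "odd (pair_swap i x) = odd (lift id {i} x)"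
      unfolding half_lift[OF sub] odd_lift[OF sub] by auto
  qed
qed

lemma pair_swap_in_dyadic_group:
  assumes "i \<in> {1..n div 2}"
  shows "pair_swap i \<in> dyadic_group n"
proof -
  have "i \<ge> 1" "\<not> n \<le> 1" "{i} \<subseteq> {1..n div 2}" using assms by auto
  then show ?thesis unfolding pair_swap_eq_lift[OF \<open>i \<ge> 1\<close>]
    by (intro lift_in_dyadic_group id_in_dyadic_group)
qed

lemma pair_swap_ne_id: "i \<ge> 1 \<Longrightarrow> pair_swap i \<noteq> id"
  unfolding pair_swap_def transpose_eq_id_iff by auto

lemma evenperm_pair_swap: "i \<ge> 1 \<Longrightarrow> \<not> evenperm (pair_swap i)"
  unfolding pair_swap_def evenperm_swap by auto

lemma permutation_pair_swap: "permutation (pair_swap i)"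
  unfolding pair_swap_def by (rule permutation_swap_id)

lemma conj_comp:
  assumes x: "x permutes S"
  shows "x \<circ> (y \<circ> z) \<circ> inv' x = (x \<circ> y \<circ> inv' x) \<circ> (x \<circ> z \<circ> inv' x)"
  by (simp add: fun_eq_iff permutes_inverses[OF x])

lemma conj_transpose:
  assumes x: "x permutes S"
  shows "x \<circ> Transposition.transpose a b \<circ> inv' x = Transposition.transpose (x a) (x b)"
proof
  fix y
  obtain i where y: "y = x i" using surjD[OF permutes_surj[OF x]] by metis
  show "(x \<circ> Transposition.transpose a b \<circ> inv' x) y = Transposition.transpose (x a) (x b) y"
    using permutes_inj[OF x] by (simp add: y permutes_inverses[OF x] Transposition.transpose_def inj_eq)
qed

lemma conj_pair_swap:
  assumes x: "x permutes {1..n}" and i: "i \<in> common_pairs n x"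
  shows "\<exists>i'\<in>{1..n div 2}. x \<circ> pair_swap i \<circ> inv' x = pair_swap i'"
proof -
  obtain i' where i': "i' \<in> {1..n div 2}" "x ` pair i = pair i'"
    using i by (auto simp only: common_pairs_def mem_Collect_eq image_iff)
  have "{x (2 * i - 1), x (2 * i)} = {2 * i' - 1, 2 * i'}" using i'(2) by (simp add: pair_def)
  then have "Transposition.transpose (x (2 * i - 1)) (x (2 * i)) = Transposition.transpose (2 * i' - 1) (2 * i')"
    by (auto simp: doubleton_eq_iff transpose_commute)
  then show ?thesis using i'(1) conj_transpose[OF x] unfolding pair_swap_def by metis
qed

text \<open>To be applied with \<open>H\<close> the elements whose conjugate also lies in the group,
  possibly restricted to even ones. The involution is a power of \<open>g\<close>, so closure under
  composition keeps it in \<open>H\<close>.\<close>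

lemma involution_power:
  assumes g: "g \<in> dyadic_group n" "g \<noteq> id"
    and H: "g \<in> H" "id \<in> H" "\<And>y z. y \<in> H \<Longrightarrow> z \<in> H \<Longrightarrow> y \<circ> z \<in> H"
  shows "\<exists>z\<in>H. z \<noteq> id \<and> z \<circ> z = id"
proof -
  interpret S: group "sym_group n" by (rule sym_group_is_group)
  have "\<exists>j::nat. g [^]\<^bsub>sym_group n\<^esub> j \<noteq> \<one>\<^bsub>sym_group n\<^esub>
      \<and> g [^]\<^bsub>sym_group n\<^esub> j \<otimes>\<^bsub>sym_group n\<^esub> g [^]\<^bsub>sym_group n\<^esub> j = \<one>\<^bsub>sym_group n\<^esub>"
    using dyadic_group_sylow[of n] g
    by (intro S.exists_involution[of "dyadic_group n"]) (auto simp: sylow_subgroup_def sym_group_one)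
  moreover have "g [^]\<^bsub>sym_group n\<^esub> (j::nat) \<in> H" for j
  proof (induction j)
    case 0
    show ?case unfolding S.nat_pow_0 sym_group_one by (rule H(2))
  next
    case (Suc j)
    then show ?case unfolding S.nat_pow_Suc sym_group_mult using H(1,3) by blast
  qed
  ultimately show ?thesis unfolding sym_group_mult sym_group_one by blast
qed

text \<open>Pigeonhole: the points of pairs swapped by \<open>z\<close> and the x-preimages of
  points of pairs swapped by the conjugate all lie among the points moved by \<open>z\<close>. As x
  is not bad, they are too many to be disjoint.\<close>

lemma flipped_common_pair:
  assumes x: "x permutes {1..n}" "x \<notin> bad_conjugators n"
    and z: "z \<in> invols n" "z \<noteq> id" "x \<circ> z \<circ> inv' x \<in> dyadic_group n"
  shows "\<exists>i. i \<in> flipped n z \<and> i \<in> common_pairs n x"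
proof -
  define z' where "z' = x \<circ> z \<circ> inv' x"
  define A where "A = \<Union> (pair ` flipped n z)"
  define A' where "A' = inv' x ` \<Union> (pair ` flipped n z')"
  have zx: "z' (x a) = x (z a)" for a by (simp add: z'_def permutes_inverses[OF x(1)])
  have fl: "flipped n y \<subseteq> {1..n div 2}" for y by (auto simp: flipped_def)
  have cU: "card (\<Union> (pair ` flipped n y)) = 2 * card (flipped n y)" for y
  proof -
    have "card (\<Union> (pair ` flipped n y)) = (\<Sum>i\<in>flipped n y. card (pair i))"
    proof (rule card_UN_disjoint)
      show "finite (flipped n y)" using fl[of y] by (rule finite_subset) simp
      show "\<forall>i\<in>flipped n y. finite (pair i)" by (simp add: pair_def)
      show "\<forall>i\<in>flipped n y. \<forall>j\<in>flipped n y. i \<noteq> j \<longrightarrow> pair i \<inter> pair j = {}"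
        using fl[of y] pairs_disjoint_doubletons(3) by blast
    qed
    also have "\<dots> = (\<Sum>i\<in>flipped n y. 2)" using fl[of y] pairs_disjoint_doubletons(1) by (intro sum.cong refl) blast
    finally show ?thesis by simp
  qed
  have swap: "y (2 * i - 1) = 2 * i" "y (2 * i) = 2 * i - 1" "2 * i - 1 \<noteq> 2 * i" if "i \<in> flipped n y" for i y
    using that by (auto simp: flipped_def)
  have mv: "\<Union> (pair ` flipped n y) \<subseteq> moved y" for y
  proof clarify
    fix a i assume i: "i \<in> flipped n y" and "a \<in> pair i"
    then have "a = 2 * i - 1 \<or> a = 2 * i" by (simp add: pair_def)
    then show "a \<in> moved y" using swap[OF i] by (auto simp only: moved_def mem_Collect_eq)
  qed
  have AM: "A \<subseteq> moved z" unfolding A_def by (rule mv)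
  have "inv' x b \<in> moved z" if "b \<in> moved z'" for b
  proof -
    have "z' b = x (z (inv' x b))" by (simp add: z'_def)
    then show ?thesis using that permutes_inverses[OF x(1)] by (auto simp: moved_def)
  qed
  then have AM': "A' \<subseteq> moved z" unfolding A'_def using mv[of z'] by blast
  have finm: "finite (moved z)"
    using moved_permutes[OF invols_permutes[OF z(1)]] by (rule finite_subset) simp
  have cA: "card A = 2 * card (flipped n z)" unfolding A_def by (rule cU)
  have cA': "card A' = 2 * card (flipped n z')"
    unfolding A'_def using card_image[OF permutes_inj_on[OF permutes_inv[OF x(1)]]] cU by metis
  have "\<not> card A + card A' \<le> card (moved z)"
    using x z unfolding bad_conjugators_def cA cA' z'_def by blast
  moreover have "card A + card A' = card (A \<union> A')" if "A \<inter> A' = {}"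
    using that AM AM' finm by (intro card_Un_disjoint[symmetric]) (auto intro: finite_subset)
  moreover have "card (A \<union> A') \<le> card (moved z)" using AM AM' by (intro card_mono finm) blast
  ultimately have "A \<inter> A' \<noteq> {}" by auto
  then obtain a b where "a \<in> A" "a = inv' x b" "b \<in> \<Union> (pair ` flipped n z')" unfolding A'_def by blast
  moreover from this have "x a = b" using permutes_inverses[OF x(1)] by simp
  ultimately have "a \<in> A" "x a \<in> \<Union> (pair ` flipped n z')" by simp_all
  then obtain i i' where a: "i \<in> flipped n z" "a \<in> pair i" "i' \<in> flipped n z'" "x a \<in> pair i'"
    unfolding A_def by blast
  \<comment> \<open>A shared point \<open>a\<close> determines both pairs, and x carries
    \<open>z a\<close> to \<open>z' (x a)\<close>, so it maps the one pair onto the other.\<close>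
  have "pair i = {a, z a}" using a(2) swap[OF a(1)] by (auto simp: pair_def)
  moreover have "pair i' = {x a, z' (x a)}" using a(4) swap[OF a(3)] by (auto simp: pair_def)
  ultimately have "x ` pair i = pair i'" by (simp add: zx)
  then have "i \<in> common_pairs n x" using fl a(1,3) unfolding common_pairs_def by blast
  then show ?thesis using a(1) by blast
qed

lemma trivial_inter_dyadic_iff:
  assumes x: "x permutes {1..n}" "x \<notin> bad_conjugators n"
  shows "trivial_inter (dyadic_group n) x \<longleftrightarrow> common_pairs n x = {}"
proof
  assume triv: "trivial_inter (dyadic_group n) x"
  show "common_pairs n x = {}"
  proof (rule ccontr)
    assume "common_pairs n x \<noteq> {}"
    then obtain i where i: "i \<in> common_pairs n x" by blast
    then have im: "i \<in> {1..n div 2}" by (simp add: common_pairs_def)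
    obtain i' where "i' \<in> {1..n div 2}" "x \<circ> pair_swap i \<circ> inv' x = pair_swap i'"
      using conj_pair_swap[OF x(1) i] by blast
    then have "x \<circ> pair_swap i \<circ> inv' x \<in> dyadic_group n" by (simp only: pair_swap_in_dyadic_group)
    then have "pair_swap i = id" using triv pair_swap_in_dyadic_group[OF im] unfolding trivial_inter_def by blast
    then show False using pair_swap_ne_id[of i] im by auto
  qed
next
  assume empty: "common_pairs n x = {}"
  show "trivial_inter (dyadic_group n) x"
    unfolding trivial_inter_def
  proof (intro ballI impI, rule ccontr)
    fix g assume g: "g \<in> dyadic_group n" "x \<circ> g \<circ> inv' x \<in> dyadic_group n" "g \<noteq> id"
    define H where "H = {z \<in> dyadic_group n. x \<circ> z \<circ> inv' x \<in> dyadic_group n}"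
    have "x \<circ> id \<circ> inv' x = id" by (simp add: fun_eq_iff permutes_inverses[OF x(1)])
    then have "id \<in> H" unfolding H_def using id_in_dyadic_group[of n] by (simp only: mem_Collect_eq)
    moreover have "y \<circ> z \<in> H" if "y \<in> H" "z \<in> H" for y z
      using that comp_in_dyadic_group unfolding H_def mem_Collect_eq conj_comp[OF x(1)] by blast
    moreover have "g \<in> H" unfolding H_def using g by blast
    ultimately obtain z where z: "z \<in> H" "z \<noteq> id" "z \<circ> z = id"
      using involution_power[OF g(1,3), of H] by blast
    then have "z \<in> invols n" "x \<circ> z \<circ> inv' x \<in> dyadic_group n" unfolding H_def invols_def by blast+
    then show False using flipped_common_pair[OF x _ z(2)] empty by blast
  qed
qed

text \<open>The swaps of two common pairs have an even product that survives conjugation.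
  Conversely, cancelling one common pair in an even common involution leaves an odd, hence
  nontrivial, common involution, which provides a second pair.\<close>

lemma trivial_inter_even_dyadic_iff:
  assumes x: "x permutes {1..n}" "x \<notin> bad_conjugators n"
  shows "trivial_inter {z \<in> dyadic_group n. evenperm z} x \<longleftrightarrow> card (common_pairs n x) \<le> 1"
proof
  assume triv: "trivial_inter {z \<in> dyadic_group n. evenperm z} x"
  show "card (common_pairs n x) \<le> 1"
  proof (rule ccontr)
    assume "\<not> card (common_pairs n x) \<le> 1"
    then have "\<not> (\<forall>i\<in>common_pairs n x. \<forall>k\<in>common_pairs n x. i = k)"
      using card_le_Suc0_iff_eq[OF finite_common_pairs] by simp
    then obtain i k where ik: "i \<in> common_pairs n x" "k \<in> common_pairs n x" "i \<noteq> k" by blast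
    then have m: "i \<in> {1..n div 2}" "k \<in> {1..n div 2}" by (auto simp: common_pairs_def)
    obtain i' where i': "i' \<in> {1..n div 2}" "x \<circ> pair_swap i \<circ> inv' x = pair_swap i'"
      using conj_pair_swap[OF x(1) ik(1)] by blast
    obtain k' where k': "k' \<in> {1..n div 2}" "x \<circ> pair_swap k \<circ> inv' x = pair_swap k'"
      using conj_pair_swap[OF x(1) ik(2)] by blast
    have in_group: "pair_swap a \<circ> pair_swap b \<in> {z \<in> dyadic_group n. evenperm z}"
      if "a \<in> {1..n div 2}" "b \<in> {1..n div 2}" for a b
    proof -
      have "evenperm (pair_swap a \<circ> pair_swap b)"
        using evenperm_pair_swap[of a] evenperm_pair_swap[of b] that
        by (subst evenperm_comp) (auto simp: permutation_pair_swap)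
      then show ?thesis using comp_in_dyadic_group pair_swap_in_dyadic_group that by blast
    qed
    have "x \<circ> (pair_swap i \<circ> pair_swap k) \<circ> inv' x \<in> {z \<in> dyadic_group n. evenperm z}"
      unfolding conj_comp[OF x(1)] i'(2) k'(2) by (rule in_group[OF i'(1) k'(1)])
    then have "pair_swap i \<circ> pair_swap k = id"
      using triv in_group[OF m] unfolding trivial_inter_def by blast
    then have "(pair_swap i \<circ> pair_swap k) (2 * i) = 2 * i" by simp
    moreover have "pair_swap k (2 * i) = 2 * i"
      unfolding pair_swap_def
    proof (rule transpose_apply_other)
      have "k \<ge> 1" using m by simp
      then show "2 * i \<noteq> 2 * k - 1" by presburger
      show "2 * i \<noteq> 2 * k" using ik(3) by simp
    qed
    moreover have "pair_swap i (2 * i) = 2 * i - 1" by (simp add: pair_swap_def)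
    moreover have "2 * i - 1 \<noteq> 2 * i" using m by auto
    ultimately show False by simp
  qed
next
  assume le: "card (common_pairs n x) \<le> 1"
  show "trivial_inter {z \<in> dyadic_group n. evenperm z} x"
    unfolding trivial_inter_def
  proof (intro ballI impI, rule ccontr)
    fix g assume g: "g \<in> {z \<in> dyadic_group n. evenperm z}" "g \<noteq> id"
      "x \<circ> g \<circ> inv' x \<in> {z \<in> dyadic_group n. evenperm z}"
    define H where "H = {z \<in> dyadic_group n. evenperm z \<and> x \<circ> z \<circ> inv' x \<in> dyadic_group n}"
    have perm: "permutation z" if "z \<in> dyadic_group n" for z
      using dyadic_group_permutes[OF that] permutation_permutes by blast
    have "x \<circ> id \<circ> inv' x = id" by (simp add: fun_eq_iff permutes_inverses[OF x(1)])
    then have "id \<in> H" unfolding H_def using id_in_dyadic_group[of n] evenperm_id by (simp only: mem_Collect_eq simp_thms)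
    moreover have "y \<circ> z \<in> H" if "y \<in> H" "z \<in> H" for y z
    proof -
      have yz: "y \<in> dyadic_group n" "z \<in> dyadic_group n" "evenperm y" "evenperm z"
        "x \<circ> y \<circ> inv' x \<in> dyadic_group n" "x \<circ> z \<circ> inv' x \<in> dyadic_group n"
        using that unfolding H_def by blast+
      have "evenperm (y \<circ> z)" using evenperm_comp[OF perm perm] yz by simp
      then show ?thesis unfolding H_def mem_Collect_eq conj_comp[OF x(1)]
        by (intro conjI comp_in_dyadic_group yz)
    qed
    moreover have "g \<in> H" unfolding H_def using g by blast
    moreover have "g \<in> dyadic_group n" using g by blast
    ultimately obtain z where z: "z \<in> H" "z \<noteq> id" "z \<circ> z = id"
      using involution_power[of g n H] g(2) by blast
    then have zd: "z \<in> dyadic_group n" "evenperm z" "x \<circ> z \<circ> inv' x \<in> dyadic_group n" "z \<in> invols n"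
      unfolding H_def invols_def by blast+
    obtain i where i: "i \<in> flipped n z" "i \<in> common_pairs n x"
      using flipped_common_pair[OF x zd(4) z(2) zd(3)] by blast
    then have im: "i \<in> {1..n div 2}" by (simp add: common_pairs_def)
    have i1: "i \<ge> 1" using im by simp
    \<comment> \<open>\<open>y\<close> is \<open>z\<close> with pair \<open>i\<close> left in place.
      Being odd, it leaves the alternating group, but it stays in the dyadic group, where
      \<open>flipped_common_pair\<close> applies.\<close>
    define y where "y = z \<circ> pair_swap i"
    have zi: "z (2 * i - 1) = 2 * i" "z (2 * i) = 2 * i - 1" using i(1) by (auto simp: flipped_def)
    have ne: "2 * i - 1 \<noteq> 2 * i" using i1 by simp
    have zz: "z (z a) = a" for a using z(3) by (simp add: fun_eq_iff)
    have y_eq: "y a = (if a = 2 * i - 1 \<or> a = 2 * i then a else z a)" for a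
      using zi ne by (auto simp: y_def pair_swap_def Transposition.transpose_def)
    have "y \<circ> y = id"
    proof
      fix a
      have "z a = 2 * i - 1 \<longleftrightarrow> a = 2 * i" "z a = 2 * i \<longleftrightarrow> a = 2 * i - 1" using zi zz by metis+
      then show "(y \<circ> y) a = id a" by (auto simp: y_eq zz)
    qed
    moreover have yd: "y \<in> dyadic_group n"
      unfolding y_def by (intro comp_in_dyadic_group zd(1) pair_swap_in_dyadic_group im)
    ultimately have yi: "y \<in> invols n" unfolding invols_def by blast
    have "\<not> evenperm y"
      unfolding y_def using zd(2) evenperm_pair_swap[OF i1] evenperm_comp[OF perm[OF zd(1)] permutation_pair_swap] by simp
    then have "y \<noteq> id" using evenperm_id by metis
    moreover have "x \<circ> y \<circ> inv' x \<in> dyadic_group n"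
    proof -
      obtain i' where "i' \<in> {1..n div 2}" "x \<circ> pair_swap i \<circ> inv' x = pair_swap i'"
        using conj_pair_swap[OF x(1) i(2)] by blast
      then show ?thesis unfolding y_def conj_comp[OF x(1)]
        using comp_in_dyadic_group[OF zd(3)] pair_swap_in_dyadic_group by metis
    qed
    ultimately obtain k where k: "k \<in> flipped n y" "k \<in> common_pairs n x"
      using flipped_common_pair[OF x yi] by blast
    have "k \<noteq> i"
    proof
      assume "k = i"
      then have "y (2 * i) = 2 * i - 1" using k(1) by (simp add: flipped_def)
      then show False using ne by (simp add: y_eq)
    qed
    moreover have "k = i" using le k(2) i(2) card_le_Suc0_iff_eq[OF finite_common_pairs] by (metis One_nat_def)
    ultimately show False by blast
  qed
qed

text \<open>Composition with the odd element \<open>pair_swap 1\<close>, available for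
  \<open>n \<ge> 2\<close>, exchanges even and odd elements. So the even half has half the order,
  just as the alternating group has half of \<open>fact n\<close>.\<close>

lemma even_dyadic_group_sylow:
  assumes n: "n \<ge> 2"
  shows "sylow_subgroup 2 {z \<in> dyadic_group n. evenperm z} (alt_group n)"
proof -
  define E where "E = {z \<in> dyadic_group n. evenperm z}"
  define D where "D = {z \<in> dyadic_group n. \<not> evenperm z}"
  define s where "s = pair_swap 1"
  have perm: "permutation z" if "z \<in> dyadic_group n" for z
    using dyadic_group_permutes[OF that] permutation_permutes by blast
  have "(1::nat) \<in> {1..n div 2}" using n by simp
  then have s: "s \<in> dyadic_group n" "\<not> evenperm s"
    unfolding s_def by (rule pair_swap_in_dyadic_group, intro evenperm_pair_swap) simp
  have ss: "s \<circ> (s \<circ> z) = z" for z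
    by (simp add: s_def pair_swap_def fun_eq_iff)
  have ev: "evenperm (s \<circ> z) \<longleftrightarrow> \<not> evenperm z" if "z \<in> dyadic_group n" for z
    using evenperm_comp[OF perm[OF s(1)] perm[OF that]] s(2) by simp
  have "bij_betw (\<lambda>z. s \<circ> z) E D"
  proof (rule bij_betw_byWitness[where f' = "\<lambda>z. s \<circ> z"])
    show "(\<lambda>z. s \<circ> z) ` E \<subseteq> D" "(\<lambda>z. s \<circ> z) ` D \<subseteq> E"
      unfolding E_def D_def using ev comp_in_dyadic_group[OF s(1)] by blast+
  qed (auto simp only: ss)
  then have "card E = card D" by (rule bij_betw_same_card)
  moreover have "card (dyadic_group n) = card E + card D"
  proof -
    have "dyadic_group n = E \<union> D" "E \<inter> D = {}" by (auto simp: E_def D_def)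
    then show ?thesis using finite_dyadic_group[of n] by (simp add: card_Un_disjoint)
  qed
  ultimately have "2 * card E = 2 ^ multiplicity 2 (fact n :: nat)" by (simp add: card_dyadic_group)
  moreover have "multiplicity 2 (fact n :: nat) = Suc (multiplicity 2 (Coset.order (alt_group n)))"
  proof -
    have "(fact n :: nat) = 2 * Coset.order (alt_group n)"
      using alt_group_card_carrier[OF n] by (simp add: Coset.order_def)
    moreover have "Coset.order (alt_group n) \<noteq> 0" using calculation by (metis fact_nonzero mult_0_right)
    ultimately show ?thesis by (simp add: multiplicity_times_same)
  qed
  ultimately have "card E = 2 ^ multiplicity 2 (Coset.order (alt_group n))" by simp
  moreover have "subgroup E (alt_group n)"
  proof (rule subgroup.intro)
    show "E \<subseteq> carrier (alt_group n)" unfolding E_def by (auto simp only: alt_group_carrier intro: dyadic_group_permutes)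
    show "\<one>\<^bsub>alt_group n\<^esub> \<in> E" unfolding E_def alt_group_one using id_in_dyadic_group evenperm_id by blast
    show "y \<otimes>\<^bsub>alt_group n\<^esub> z \<in> E" if "y \<in> E" "z \<in> E" for y z
    proof -
      have yz: "y \<in> dyadic_group n" "z \<in> dyadic_group n" "evenperm y" "evenperm z" using that by (auto simp: E_def)
      have "evenperm (y \<circ> z)" using evenperm_comp[OF perm perm] yz by simp
      then show ?thesis unfolding E_def alt_group_mult using comp_in_dyadic_group yz by blast
    qed
    show "inv\<^bsub>alt_group n\<^esub> z \<in> E" if "z \<in> E" for z
    proof -
      have z: "z \<in> dyadic_group n" "evenperm z" using that by (auto simp: E_def)
      then have "z \<in> carrier (alt_group n)" using dyadic_group_permutes by (simp only: alt_group_carrier)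
      then have "inv\<^bsub>alt_group n\<^esub> z = inv' z" by (rule alt_group_inv_equality)
      moreover have "evenperm (inv' z)" using evenperm_inv[OF perm[OF z(1)]] z(2) by simp
      ultimately show ?thesis unfolding E_def using inv_in_dyadic_group[OF z(1)] by simp
    qed
  qed
  ultimately show ?thesis unfolding sylow_subgroup_def E_def by blast
qed

section \<open>Collecting the error terms\<close>

lemma prob_approx_outside_bad:
  assumes n: "n > 0" and iff: "\<And>x. x permutes {1..n} \<Longrightarrow> x \<notin> bad_conjugators n \<Longrightarrow> R x \<longleftrightarrow> S x"
  shows "\<bar>card {x. x permutes {1..n} \<and> R x} / fact n - card {x. x permutes {1..n} \<and> S x} / fact n\<bar>
    \<le> 64 * exp 8 / real n"
proof -
  let ?P = "{x. x permutes {1..n}}"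
  have fin: "finite ?P" by (rule finite_permutations) simp
  have diff: "card {x \<in> ?P. A x} \<le> card {x \<in> ?P. B x} + card (bad_conjugators n)"
    if "\<And>x. x \<in> ?P \<Longrightarrow> x \<notin> bad_conjugators n \<Longrightarrow> A x \<Longrightarrow> B x" for A B
  proof -
    have "card {x \<in> ?P. A x} \<le> card ({x \<in> ?P. B x} \<union> bad_conjugators n)"
    proof (rule card_mono)
      have "bad_conjugators n \<subseteq> ?P" unfolding bad_conjugators_def by blast
      then show "finite ({x \<in> ?P. B x} \<union> bad_conjugators n)" using fin by (simp add: finite_subset)
    qed (use that in blast)
    then show ?thesis using card_Un_le[of "{x \<in> ?P. B x}" "bad_conjugators n"] by linarith
  qed
  have "card {x \<in> ?P. R x} \<le> card {x \<in> ?P. S x} + card (bad_conjugators n)"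
    "card {x \<in> ?P. S x} \<le> card {x \<in> ?P. R x} + card (bad_conjugators n)"
    by (rule diff, use iff in blast)+
  then have "\<bar>real (card {x \<in> ?P. R x}) - real (card {x \<in> ?P. S x})\<bar> \<le> card (bad_conjugators n)" by linarith
  then have "\<bar>real (card {x \<in> ?P. R x}) - real (card {x \<in> ?P. S x})\<bar> / fact n \<le> card (bad_conjugators n) / fact n"
    by (rule divide_right_mono) simp
  also have "\<dots> \<le> 64 * exp 8 / real n" by (rule card_bad_conjugators_le[OF n])
  finally show ?thesis by (simp add: diff_divide_distrib[symmetric] abs_divide)
qed

lemma moment_const_pos: "moment_const > 0"
  by (simp add: moment_const_def)

lemma moment_const_div_le:
  assumes "n \<ge> 2"
  shows "moment_const / real (n div 2) \<le> 3 * moment_const / real n"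
proof -
  \<comment> \<open>Equality holds at \<open>n = 3\<close>.\<close>
  have "n \<le> 3 * (n div 2)" using assms by linarith
  then have "real n \<le> 3 * real (n div 2)" by linarith
  moreover have "real (n div 2) > 0" "real n > 0" using assms by auto
  ultimately show ?thesis
    using moment_const_pos mult_left_mono[of "real n" "3 * real (n div 2)" moment_const]
    by (simp add: divide_le_eq mult_ac pos_divide_le_eq pos_le_divide_eq)
qed

lemma trivial_conj_inter_prob_diff_le_1:
  assumes "0 \<le> c" "c \<le> 1"
  shows "\<bar>trivial_conj_inter_prob n P - c\<bar> \<le> 1"
proof -
  have "0 \<le> trivial_conj_inter_prob n P" "trivial_conj_inter_prob n P \<le> 1"
    unfolding trivial_conj_inter_prob_def by (auto intro: measure_pmf.prob_le_1)
  then show ?thesis using assms by linarith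
qed

lemma sylow_sym_group_estimate:
  assumes n: "n \<ge> 2" and P: "sylow_subgroup 2 P (sym_group n)"
  shows "\<bar>trivial_conj_inter_prob n P - exp (- 1 / 2)\<bar> \<le> (64 * exp 8 + 6 * moment_const) / real n"
proof -
  have "\<bar>trivial_conj_inter_prob n P - card {x. x permutes {1..n} \<and> common_pairs n x = {}} / fact n\<bar>
      \<le> 64 * exp 8 / real n"
    unfolding sylow_sym_group_prob[OF P dyadic_group_sylow]
    by (rule prob_approx_outside_bad) (use n trivial_inter_dyadic_iff in auto)
  moreover have "\<bar>card {x. x permutes {1..n} \<and> common_pairs n x = {}} / fact n - exp (- 1 / 2)\<bar>
      \<le> 3 * moment_const / real n"
    using card_no_common_pairs[of n] moment_const_div_le[OF n] n by simp
  moreover have "3 * moment_const / real n \<ge> 0" using moment_const_pos by simp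
  ultimately show ?thesis by (simp add: add_divide_distrib)
qed

text \<open>At most one common pair means none or exactly one, with limits
  \<open>exp (- 1 / 2)\<close> and half of it; the two errors account for
  \<open>6 * moment_const\<close>.\<close>

lemma sylow_alt_group_estimate:
  assumes n: "n \<ge> 2" and P: "sylow_subgroup 2 P (alt_group n)"
  shows "\<bar>trivial_conj_inter_prob n P - 3 / 2 * exp (- 1 / 2)\<bar> \<le> (64 * exp 8 + 6 * moment_const) / real n"
proof -
  let ?A = "{x. x permutes {1..n} \<and> common_pairs n x = {}}"
  let ?B = "{x. x permutes {1..n} \<and> card (common_pairs n x) = 1}"
  have "{x. x permutes {1..n} \<and> card (common_pairs n x) \<le> 1} = ?A \<union> ?B"
    using finite_common_pairs[of n] by (auto simp: le_Suc_eq)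
  moreover have "finite ?A" "finite ?B" "?A \<inter> ?B = {}"
    using finite_permutations[of "{1..n}"] by auto
  ultimately have "card {x. x permutes {1..n} \<and> card (common_pairs n x) \<le> 1} = card ?A + card ?B"
    by (simp only: card_Un_disjoint)
  then have "card {x. x permutes {1..n} \<and> card (common_pairs n x) \<le> 1} / fact n
      = card ?A / fact n + card ?B / (fact n :: real)"
    by (simp only: of_nat_add add_divide_distrib)
  moreover have "\<bar>trivial_conj_inter_prob n P
      - card {x. x permutes {1..n} \<and> card (common_pairs n x) \<le> 1} / fact n\<bar> \<le> 64 * exp 8 / real n"
    unfolding sylow_alt_group_prob[OF P even_dyadic_group_sylow[OF n]]
    by (rule prob_approx_outside_bad) (use n in simp, rule trivial_inter_even_dyadic_iff)
  ultimately have "\<bar>trivial_conj_inter_prob n P - (card ?A / fact n + card ?B / fact n)\<bar> \<le> 64 * exp 8 / real n"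
    by (simp only:)
  moreover have "\<bar>card ?A / fact n - exp (- 1 / 2)\<bar> \<le> 3 * moment_const / real n"
    using card_no_common_pairs[of n] moment_const_div_le[OF n] n by simp
  moreover have "\<bar>card ?B / fact n - exp (- 1 / 2) / 2\<bar> \<le> 3 * moment_const / real n"
    using card_one_common_pair[of n] moment_const_div_le[OF n] n by simp
  moreover have "(64 * exp 8 + 6 * moment_const) / real n
      = 64 * exp 8 / real n + 3 * moment_const / real n + 3 * moment_const / real n"
    by (simp add: add_divide_distrib[symmetric])
  ultimately show ?thesis by linarith
qed

text \<open>The moment estimates require \<open>n div 2 > 0\<close>; for \<open>n = 1\<close> the
  constant exceeds 1, so the trivial bound does.\<close>

lemma trivial_conj_inter_prob_1_estimate:
  assumes "0 \<le> c" "c \<le> 1"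
  shows "\<bar>trivial_conj_inter_prob 1 P - c\<bar> \<le> (64 * exp 8 + 6 * moment_const) / real 1"
proof -
  have "1 \<le> 64 * exp (8 :: real)" using exp_ge_add_one_self[of 8] by simp
  then have "1 \<le> (64 * exp 8 + 6 * moment_const) / real 1" using moment_const_pos by simp
  then show ?thesis using trivial_conj_inter_prob_diff_le_1[OF assms] order_trans by blast
qed

theorem theorem1:
  shows "(\<exists>C::real. \<forall>n::nat. n > 0 \<longrightarrow>
            (\<forall>P. sylow_subgroup 2 P (sym_group n) \<longrightarrow>
               \<bar>trivial_conj_inter_prob n P - exp (- 1 / 2)\<bar> \<le> C / real n))
       \<and> (\<exists>C::real. \<forall>n::nat. n > 0 \<longrightarrow>
            (\<forall>P. sylow_subgroup 2 P (alt_group n) \<longrightarrow>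
               \<bar>trivial_conj_inter_prob n P - 3 / 2 * exp (- 1 / 2)\<bar> \<le> C / real n))"
proof -
  \<comment> \<open>This makes the alternating limit at most 1, as the trivial bound for
    \<open>n = 1\<close> demands.\<close>
  have "3 / 2 \<le> exp (1 / 2 :: real)" using exp_ge_add_one_self[of "1 / 2"] by simp
  then have e: "3 / 2 * exp (- 1 / 2) \<le> (1 :: real)" "exp (- 1 / 2) \<le> (1 :: real)"
    by (simp_all add: exp_minus field_simps)
  have cases: "n = 1 \<or> n \<ge> 2" if "n > 0" for n :: nat using that by linarith
  show ?thesis
  proof (intro conjI exI allI impI)
    fix n :: nat and P assume n: "n > 0" and P: "sylow_subgroup 2 P (sym_group n)"
    show "\<bar>trivial_conj_inter_prob n P - exp (- 1 / 2)\<bar> \<le> (64 * exp 8 + 6 * moment_const) / real n"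
      using cases[OF n] sylow_sym_group_estimate[OF _ P] trivial_conj_inter_prob_1_estimate[of "exp (- 1 / 2)" P] e by auto
  next
    fix n :: nat and P assume n: "n > 0" and P: "sylow_subgroup 2 P (alt_group n)"
    show "\<bar>trivial_conj_inter_prob n P - 3 / 2 * exp (- 1 / 2)\<bar> \<le> (64 * exp 8 + 6 * moment_const) / real n"
      using cases[OF n] sylow_alt_group_estimate[OF _ P] trivial_conj_inter_prob_1_estimate[of "3 / 2 * exp (- 1 / 2)" P] e by auto
  qed
qed

end
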